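(* Let $(\tilde A,\tilde B,\tilde C,\tilde D)$ be a stable balanced system, and let $\epsilon,\gamma,r,q,U$, $Q_E=\|\tilde B_2+\tilde C_2^*U\|$, $Q_U=\|I-UU^*\|$ and the blocks $\tilde A_{22},\tilde B_2,\tilde C_2$ be as defined in the context. Let $s_1\ge\cdots\ge s_p\ge0$ be the singular values of $\tilde C_2$ (padded by zeros if necessary), and set $s_{p+1}=0$ when $p=q$. The following statements hold: (a) The quantity $Q_E$ satisfies $Q_E\le Q_1+Q_2$, where $$Q_1=\gamma+\sqrt{\gamma^2+4\epsilon\|\tilde A_{22}\|},\qquad Q_2=\frac{4\sqrt2\,\epsilon\|\tilde A_{22}\|_F}{(s_q-s_{q+1})-4\epsilon\|\tilde A_{22}\|_F}\,\|\tilde B_2\| .$$ Moreover, in this bound one may take $Q_1=0$ when $q=r$, and $Q_2=0$ when $q=r$ or $\tilde A_{22}$ is Hermitian. (b) The quantity $Q_U$ satisfies $$Q_U\le 4s_q^{-2}\,\epsilon\,\|\tilde A_{22}\|,$$ and $Q_U$ is zero when $\tilde A_{22}$ is Hermitian.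
   Context: Norms: $\|\cdot\|$ is the matrix spectral norm and $\|\cdot\|_F$ the Frobenius norm. Intermediate system: $\tilde A\in\mathbb{C}^{K\times K}$, $\tilde B\in\mathbb{C}^{K\times m}$, $\tilde C\in\mathbb{C}^{p\times K}$, $\tilde D\in\mathbb{C}^{p\times m}$, with $p\le m$ and the spectrum of $\tilde A$ in the open left half-plane. Let $\tilde\sigma_1\ge\cdots\ge\tilde\sigma_K\ge0$ be its Hankel singular values, $k$ the target rank, and $\epsilon\ge0$ a tolerance. Let $j_1\le k+1\le j_2$ be such that $\tilde\sigma_{j_1},\dots,\tilde\sigma_{j_2}$ are exactly the Hankel singular values with $|\tilde\sigma_j-\tilde\sigma_{k+1}|\le\epsilon$, and let $r=j_2-j_1+1$. The system is balanced: with $\tilde\Sigma_1=\mathrm{diag}(\tilde\sigma_1,\dots,\tilde\sigma_{j_1-1},\tilde\sigma_{j_2+1},\dots,\tilde\sigma_K)$, $\tilde\Sigma_2=\mathrm{diag}(\tilde\sigma_{j_1},\dots,\tilde\sigma_{j_2})$ and $\tilde P=\tilde Q=\mathrm{diag}(\tilde\Sigma_1,\tilde\Sigma_2)$ one has the Lyapunov equations $\tilde A\tilde P+\tilde P\tilde A^*+\tilde B\tilde B^*=0$ and $\tilde A^*\tilde Q+\tilde Q\tilde A+\tilde C^*\tilde C=0$. Partition conformally $$\tilde A=\begin{bmatrix}\tilde A_{11}&\tilde A_{12}\\ \tilde A_{21}&\tilde A_{22}\end{bmatrix},\quad \tilde B=\begin{bmatrix}\tilde B_1\\ \tilde B_2\end{bmatrix},\quad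 \tilde C=\begin{bmatrix}\tilde C_1&\tilde C_2\end{bmatrix},$$ with $\tilde A_{22}\in\mathbb{C}^{r\times r}$, $\tilde B_2\in\mathbb{C}^{r\times m}$, $\tilde C_2\in\mathbb{C}^{p\times r}$. Construction of $U$: fix a threshold $\gamma\ge0$. Let $\tilde C_2^*=U_CS_CV_C^*$ be an SVD ($U_C\in\mathbb{C}^{r\times r}$, $S_C\in\mathbb{C}^{r\times p}$, $V_C\in\mathbb{C}^{p\times p}$), with singular values in decreasing order. Write $U_C=[\,U_C^{(1)}\mid U_C^{(2)}\,]$ and $S_C=\begin{bmatrix}S_C^{(1)}&0\\0&S_C^{(2)}\end{bmatrix}$ with $U_C^{(1)}\in\mathbb{C}^{r\times q}$, $S_C^{(1)}\in\mathbb{R}^{q\times q}$ invertible, where $1\le q\le \min(r,p)$ is the smallest number with $\|S_C^{(2)}\|\le\gamma$ (an empty block has norm $0$). Let $V_B^{(1)}\in\mathbb{C}^{m\times q}$ be given by $(V_B^{(1)})^*=-(S_C^{(1)})^{-1}(U_C^{(1)})^*\tilde B_2$, the least-squares solution of $(U_C^{(1)}S_C^{(1)})X=-\tilde B_2$. Let $V_B=[\,V_B^{(1)}\mid V_B^{(2)}\,]\in\mathbb{C}^{m\times p}$, where the $p-q$ columns of $V_B^{(2)}$ are arbitrary orthonormal vectors orthogonal to the column space of $V_B^{(1)}$. Set $U=V_CV_B^*\in\mathbb{C}^{p\times m}$.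
   Formalization: The bound Q_E ≤ Q_1+Q_2 is stated only when the denominator (s_q − s_{q+1}) − 4ε‖Ã_22‖_F of Q_2 is positive; otherwise Q_2 is undefined or negative and the bound can fail. The "moreover" cases and (b) carry no such condition. *)

theory Defs
  imports
    "HOL-Analysis.L2_Norm"
    "Jordan_Normal_Form.Schur_Decomposition"
    "Jordan_Normal_Form.Gauss_Jordan_Elimination"
    "Jordan_Normal_Form.Spectral_Radius"
begin

definition vec_norm2 :: "complex vec \<Rightarrow> real" where
  "vec_norm2 v = L2_set (\<lambda>i. cmod (v $ i)) {..<dim_vec v}"

text \<open>The supremum ranges over the closed unit ball rather than the unit sphere,
  so that a matrix without rows or without columns has norm 0.\<close>

definition spectral_norm :: "complex mat \<Rightarrow> real" where
  "spectral_norm M =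
     (SUP v\<in>{v \<in> carrier_vec (dim_col M). vec_norm2 v \<le> 1}. vec_norm2 (M *\<^sub>v v))"

definition frobenius_norm :: "complex mat \<Rightarrow> real" where
  "frobenius_norm M = L2_set (\<lambda>ij. cmod (M $$ ij)) ({..<dim_row M} \<times> {..<dim_col M})"

definition hermitian_mat :: "complex mat \<Rightarrow> bool" where
  "hermitian_mat A \<longleftrightarrow> mat_adjoint A = A"

definition unitary_mat :: "nat \<Rightarrow> complex mat \<Rightarrow> bool" where
  "unitary_mat n U \<longleftrightarrow> U \<in> carrier_mat n n \<and> mat_adjoint U * U = 1\<^sub>m n \<and> U * mat_adjoint U = 1\<^sub>m n"

definition append_cols :: "'a :: zero mat \<Rightarrow> 'a mat \<Rightarrow> 'a mat" (infixr \<open>@\<^sub>c\<close> 65) where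
  "A @\<^sub>c B = four_block_mat A B (0\<^sub>m 0 (dim_col A)) (0\<^sub>m 0 (dim_col B))"

definition real_diag :: "real list \<Rightarrow> complex mat" where
  "real_diag xs = mat_diag (length xs) (\<lambda>i. complex_of_real (xs ! i))"

text \<open>Removes the first \<open>q\<close> rows and the first \<open>q\<close> columns.\<close>

definition trailing_block :: "nat \<Rightarrow> 'a mat \<Rightarrow> 'a mat" where
  "trailing_block q M = (case split_block M q q of (_, _, _, M22) \<Rightarrow> M22)"

text \<open>\<open>s 1 \<ge> \<dots> \<ge> s n \<ge> 0\<close> are the square roots of the eigenvalues of the \<open>n \<times> n\<close> matrix \<open>M\<close>,
  counted with algebraic multiplicity. Values of \<open>s\<close> outside \<open>{1..n}\<close> are irrelevant.\<close>

definition sqrt_eigenvalues :: "complex mat \<Rightarrow> (nat \<Rightarrow> real) \<Rightarrow> bool" where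
  "sqrt_eigenvalues M s \<longleftrightarrow>
     (\<forall>i\<in>{1..dim_row M}. 0 \<le> s i) \<and>
     (\<forall>i\<in>{1..dim_row M}. \<forall>j\<in>{1..dim_row M}. i \<le> j \<longrightarrow> s j \<le> s i) \<and>
     char_poly M = (\<Prod>i\<in>{1..dim_row M}. [:- complex_of_real ((s i)\<^sup>2), 1:])"

text \<open>For a \<open>p \<times> r\<close> matrix \<open>M\<close> this lists \<open>p\<close> values: since \<open>M M\<^sup>*\<close> is \<open>p \<times> p\<close>, the
  \<open>min p r\<close> singular values are padded by zeros when \<open>r < p\<close>.\<close>

definition singular_values :: "complex mat \<Rightarrow> (nat \<Rightarrow> real) \<Rightarrow> bool" where
  "singular_values M s \<longleftrightarrow> sqrt_eigenvalues (M * mat_adjoint M) s"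

definition is_svd :: "complex mat \<Rightarrow> complex mat \<Rightarrow> complex mat \<Rightarrow> complex mat \<Rightarrow> bool" where
  "is_svd M U S V \<longleftrightarrow>
     unitary_mat (dim_row M) U \<and> unitary_mat (dim_col M) V \<and>
     S \<in> carrier_mat (dim_row M) (dim_col M) \<and>
     (\<exists>d :: nat \<Rightarrow> real.
        (\<forall>i < min (dim_row M) (dim_col M). 0 \<le> d i) \<and>
        (\<forall>i j. i \<le> j \<longrightarrow> j < min (dim_row M) (dim_col M) \<longrightarrow> d j \<le> d i) \<and>
        (\<forall>i < dim_row M. \<forall>j < dim_col M.
           S $$ (i, j) = (if i = j then complex_of_real (d i) else 0))) \<and>
     M = U * S * mat_adjoint V"

definition stable_mat :: "complex mat \<Rightarrow> bool" where
  "stable_mat A \<longleftrightarrow> spectrum A \<subseteq> {z. Re z < 0}"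

text \<open>The Gramians are given by their Lyapunov equations, whose solutions are unique
  for stable \<open>A\<close>.\<close>

definition controllability_gramian :: "complex mat \<Rightarrow> complex mat \<Rightarrow> complex mat \<Rightarrow> bool" where
  "controllability_gramian A B P \<longleftrightarrow>
     P \<in> carrier_mat (dim_row A) (dim_row A) \<and>
     A * P + P * mat_adjoint A + B * mat_adjoint B = 0\<^sub>m (dim_row A) (dim_row A)"

definition observability_gramian :: "complex mat \<Rightarrow> complex mat \<Rightarrow> complex mat \<Rightarrow> bool" where
  "observability_gramian A C Q \<longleftrightarrow>
     Q \<in> carrier_mat (dim_row A) (dim_row A) \<and>
     mat_adjoint A * Q + Q * A + mat_adjoint C * C = 0\<^sub>m (dim_row A) (dim_row A)"

definition hankel_singular_values ::
    "complex mat \<Rightarrow> complex mat \<Rightarrow> complex mat \<Rightarrow> (nat \<Rightarrow> real) \<Rightarrow> bool" where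
  "hankel_singular_values A B C \<sigma> \<longleftrightarrow>
     (\<exists>P Q. controllability_gramian A B P \<and> observability_gramian A C Q \<and>
            sqrt_eigenvalues (P * Q) \<sigma>)"

end

theory Submission
  imports Defs
begin

text \<open>
  Write \<open>X = B2 B2\<^sup>*\<close> and \<open>Y = C2\<^sup>* C2\<close>. Both statements rest on the fact that \<open>X\<close> and \<open>Y\<close>
  are close. The Gramian is block diagonal, so the trailing blocks of the two Lyapunov equations
  are Lyapunov equations for \<open>A22\<close> with the same Gramian \<open>\<Sigma>2\<close> (\<open>lyapunov_trailing_block\<close>).
  Their difference is \<open>X - Y = [\<Sigma>2, A22 - A22\<^sup>*]\<close>. In this commutator \<open>\<Sigma>2\<close> can be replaced by
  \<open>E = \<Sigma>2 - \<sigma>\<^bsub>k+1\<^esub> I\<close>, which has norm at most \<open>\<epsilon>\<close>; hence \<open>\<parallel>X - Y\<parallel> \<le> 4 \<epsilon> \<parallel>A22\<parallel>\<close>, and \<open>X = Y\<close> if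
  \<open>A22\<close> is Hermitian (\<open>gramian_gap_norm\<close>, \<open>gramian_gap_hermitian\<close>).

  For the residual, \<open>U\<close> is constructed so that \<open>C2\<^sup>* U\<close> cancels the component of \<open>B2\<close> in the range
  of \<open>UC1\<close>, which leaves \<open>B2 + C2\<^sup>* U = UC2 (UC2\<^sup>* B2 + SC2 VB2\<^sup>*)\<close> (\<open>truncated_svd_residual\<close>).
  This is \<open>0\<close> if \<open>q = r\<close>. In general the second summand has norm at most \<open>\<gamma>\<close>. The squared norm
  of the first is at most
  \<open>\<parallel>UC2\<^sup>* X UC2\<parallel> \<le> \<parallel>UC2\<^sup>* Y UC2\<parallel> + \<parallel>X - Y\<parallel> \<le> \<gamma>\<^sup>2 + 4 \<epsilon> \<parallel>A22\<parallel>\<close>, because \<open>UC2\<^sup>* Y UC2 = SC2 SC2\<^sup>*\<close>.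
  Together \<open>QE \<le> Q1\<close>, and \<open>QE \<le> Q1 + Q2\<close> follows because \<open>Q2 \<ge> 0\<close> when the spectral gap
  exceeds \<open>4 \<epsilon>\<close> times the Frobenius norm of \<open>A22\<close>.

  For the unitarity defect, \<open>I - U U\<^sup>*\<close> is unitarily equivalent to \<open>diag (I - VB1\<^sup>* VB1, 0)\<close>
  (\<open>coisometry_defect\<close>), and \<open>I - VB1\<^sup>* VB1 = SC1\<^sup>-\<^sup>1 UC1\<^sup>* (Y - X) UC1 SC1\<^sup>-\<^sup>*\<close> since
  \<open>UC1\<^sup>* Y UC1 = SC1 SC1\<^sup>*\<close> (\<open>least_squares_gram_defect\<close>). The smallest diagonal entry of \<open>SC1\<close> is
  the singular value \<open>s q\<close> of \<open>C2\<close> (\<open>svd_singular_values\<close>), so each factor \<open>SC1\<^sup>-\<^sup>1\<close> contributes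
  at most \<open>1 / s q\<close>.
\<close>

section \<open>The Euclidean norm of complex vectors\<close>

lemma vec_norm2_nonneg: "0 \<le> vec_norm2 v"
  unfolding vec_norm2_def by (rule L2_set_nonneg)

lemma vec_norm2_0 [simp]: "vec_norm2 (0\<^sub>v n) = 0"
  by (simp add: vec_norm2_def L2_set_def)

lemma vec_norm2_smult: "vec_norm2 (c \<cdot>\<^sub>v v) = cmod c * vec_norm2 v"
  by (simp add: vec_norm2_def L2_set_right_distrib norm_mult cong: L2_set_cong_simp)

lemma vec_norm2_eq_0D:
  assumes "vec_norm2 v = 0"
  shows "v = 0\<^sub>v (dim_vec v)"
  using assms by (auto simp: vec_norm2_def L2_set_eq_0_iff)

lemma vec_norm2_triangle:
  assumes "v \<in> carrier_vec n" "w \<in> carrier_vec n"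
  shows "vec_norm2 (v + w) \<le> vec_norm2 v + vec_norm2 w"
proof -
  have "vec_norm2 (v + w) = L2_set (\<lambda>i. cmod (v $ i + w $ i)) {..<n}"
    using assms by (auto simp: vec_norm2_def intro!: L2_set_cong)
  also have "\<dots> \<le> L2_set (\<lambda>i. cmod (v $ i) + cmod (w $ i)) {..<n}"
    by (rule L2_set_mono) (auto intro: norm_triangle_ineq)
  also have "\<dots> \<le> L2_set (\<lambda>i. cmod (v $ i)) {..<n} + L2_set (\<lambda>i. cmod (w $ i)) {..<n}"
    by (rule L2_set_triangle_ineq)
  finally show ?thesis
    using assms by (simp add: vec_norm2_def)
qed

lemma cscalar_prod_self:
  "v \<bullet>c v = complex_of_real ((vec_norm2 v)\<^sup>2)"
proof -
  have "v \<bullet>c v = (\<Sum>i<dim_vec v. v $ i * cnj (v $ i))"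
    by (simp add: scalar_prod_def lessThan_atLeast0)
  also have "\<dots> = complex_of_real (\<Sum>i<dim_vec v. (cmod (v $ i))\<^sup>2)"
    unfolding of_real_sum by (intro sum.cong refl complex_norm_square[symmetric])
  also have "(\<Sum>i<dim_vec v. (cmod (v $ i))\<^sup>2) = (vec_norm2 v)\<^sup>2"
    by (simp add: vec_norm2_def L2_set_def sum_nonneg)
  finally show ?thesis .
qed

lemma cscalar_prod_Cauchy_Schwarz:
  assumes "dim_vec v = dim_vec w"
  shows "cmod (v \<bullet>c w) \<le> vec_norm2 v * vec_norm2 w"
proof -
  have "cmod (v \<bullet>c w) = cmod (\<Sum>i<dim_vec w. v $ i * cnj (w $ i))"
    by (simp add: scalar_prod_def lessThan_atLeast0)
  also have "\<dots> \<le> (\<Sum>i<dim_vec w. cmod (v $ i * cnj (w $ i)))"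
    by (rule norm_sum)
  also have "\<dots> = (\<Sum>i<dim_vec w. \<bar>cmod (v $ i)\<bar> * \<bar>cmod (w $ i)\<bar>)"
    by (simp add: norm_mult)
  also have "\<dots> \<le> L2_set (\<lambda>i. cmod (v $ i)) {..<dim_vec w} * L2_set (\<lambda>i. cmod (w $ i)) {..<dim_vec w}"
    by (rule L2_set_mult_ineq)
  finally show ?thesis
    using assms by (simp add: vec_norm2_def)
qed

section \<open>The adjoint\<close>

lemma dim_mat_adjoint [simp]:
  "dim_row (mat_adjoint A) = dim_col A" "dim_col (mat_adjoint A) = dim_row A"
  unfolding mat_adjoint_def by auto

lemma mat_adjoint_carrier [simp]:
  "A \<in> carrier_mat n m \<Longrightarrow> mat_adjoint A \<in> carrier_mat m n"
  by (rule carrier_matI) (simp_all only: dim_mat_adjoint carrier_matD)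

lemma index_mat_adjoint [simp]:
  fixes A :: "complex mat"
  assumes "i < dim_col A" "j < dim_row A"
  shows "mat_adjoint A $$ (i, j) = cnj (A $$ (j, i))"
  using assms by (simp add: mat_adjoint_def mat_of_rows_def)

lemma mat_adjoint_mat_adjoint [simp]:
  fixes A :: "complex mat"
  shows "mat_adjoint (mat_adjoint A) = A"
  by (rule eq_matI) auto

lemma mat_adjoint_mult:
  fixes A B :: "complex mat"
  assumes "dim_col A = dim_row B"
  shows "mat_adjoint (A * B) = mat_adjoint B * mat_adjoint A"
  using assms by (intro eq_matI) (auto simp: scalar_prod_def mult.commute)

lemma mat_adjoint_uminus:
  fixes A :: "complex mat"
  shows "mat_adjoint (- A) = - mat_adjoint A"
  by (rule eq_matI) auto

lemma cscalar_prod_mat_adjoint: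
  fixes A :: "complex mat"
  assumes "A \<in> carrier_mat n m" "v \<in> carrier_vec m" "w \<in> carrier_vec n"
  shows "(A *\<^sub>v v) \<bullet>c w = v \<bullet>c (mat_adjoint A *\<^sub>v w)"
proof -
  have "(A *\<^sub>v v) \<bullet>c w = (\<Sum>i<n. \<Sum>j<m. A $$ (i, j) * v $ j * cnj (w $ i))"
    using assms by (auto simp: scalar_prod_def lessThan_atLeast0 sum_distrib_right)
  also have "\<dots> = (\<Sum>j<m. \<Sum>i<n. A $$ (i, j) * v $ j * cnj (w $ i))"
    by (rule sum.swap)
  also have "\<dots> = v \<bullet>c (mat_adjoint A *\<^sub>v w)"
    using assms by (auto simp: scalar_prod_def lessThan_atLeast0 sum_distrib_left mult_ac intro!: sum.cong)
  finally show ?thesis .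
qed

section \<open>The spectral norm\<close>

text \<open>A crude bound by the sum of the norms of the rows. It makes the supremum that defines the
  spectral norm bounded, so that it is a least upper bound rather than an unspecified real.\<close>

lemma vec_norm2_mult_bound:
  "\<exists>c\<ge>0. \<forall>v\<in>carrier_vec (dim_col M). vec_norm2 (M *\<^sub>v v) \<le> c * vec_norm2 v"
proof (intro exI conjI ballI)
  show "0 \<le> (\<Sum>i<dim_row M. vec_norm2 (row M i))"
    by (simp add: sum_nonneg vec_norm2_nonneg)
next
  fix v :: "complex vec" assume v: "v \<in> carrier_vec (dim_col M)"
  have entry: "cmod ((M *\<^sub>v v) $ i) \<le> vec_norm2 (row M i) * vec_norm2 v" if "i < dim_row M" for i
  proof -
    have "vec_norm2 (conjugate v) = vec_norm2 v"
      by (simp add: vec_norm2_def cong: L2_set_cong_simp)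
    moreover have "(M *\<^sub>v v) $ i = row M i \<bullet>c conjugate v"
      using that by simp
    ultimately show ?thesis
      using cscalar_prod_Cauchy_Schwarz[of "row M i" "conjugate v"] v by simp
  qed
  have "vec_norm2 (M *\<^sub>v v) \<le> (\<Sum>i<dim_row M. cmod ((M *\<^sub>v v) $ i))"
    unfolding vec_norm2_def using L2_set_le_sum[of "{..<dim_row M}" "\<lambda>i. cmod ((M *\<^sub>v v) $ i)"] by simp
  also have "\<dots> \<le> (\<Sum>i<dim_row M. vec_norm2 (row M i)) * vec_norm2 v"
    unfolding sum_distrib_right by (rule sum_mono) (use entry in simp)
  finally show "vec_norm2 (M *\<^sub>v v) \<le> (\<Sum>i<dim_row M. vec_norm2 (row M i)) * vec_norm2 v" .
qed

lemma spectral_norm_le: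
  assumes "M \<in> carrier_mat n m"
    and "\<And>v. v \<in> carrier_vec m \<Longrightarrow> vec_norm2 (M *\<^sub>v v) \<le> c * vec_norm2 v" and "0 \<le> c"
  shows "spectral_norm M \<le> c"
  unfolding spectral_norm_def
proof (rule cSUP_least)
  have "0\<^sub>v (dim_col M) \<in> {v \<in> carrier_vec (dim_col M). vec_norm2 v \<le> 1}"
    by simp
  then show "{v \<in> carrier_vec (dim_col M). vec_norm2 v \<le> 1} \<noteq> {}"
    by blast
next
  fix v assume v: "v \<in> {v \<in> carrier_vec (dim_col M). vec_norm2 v \<le> 1}"
  then have "vec_norm2 (M *\<^sub>v v) \<le> c * vec_norm2 v"
    using assms by auto
  also have "\<dots> \<le> c"
    using v assms(3) by (simp add: mult_left_le)
  finally show "vec_norm2 (M *\<^sub>v v) \<le> c" .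
qed

lemma spectral_norm_upper_ball:
  assumes "v \<in> carrier_vec (dim_col M)" "vec_norm2 v \<le> 1"
  shows "vec_norm2 (M *\<^sub>v v) \<le> spectral_norm M"
  unfolding spectral_norm_def
proof (rule cSUP_upper)
  obtain c where c: "0 \<le> c" "\<forall>v\<in>carrier_vec (dim_col M). vec_norm2 (M *\<^sub>v v) \<le> c * vec_norm2 v"
    using vec_norm2_mult_bound by blast
  have "vec_norm2 (M *\<^sub>v w) \<le> c" if "w \<in> carrier_vec (dim_col M)" "vec_norm2 w \<le> 1" for w
    using c that by (meson mult_left_le order_trans)
  then show "bdd_above ((\<lambda>v. vec_norm2 (M *\<^sub>v v)) ` {v \<in> carrier_vec (dim_col M). vec_norm2 v \<le> 1})"
    by (auto intro!: bdd_aboveI[of _ c])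
qed (use assms in auto)

lemma spectral_norm_nonneg: "0 \<le> spectral_norm M"
  using spectral_norm_upper_ball[of "0\<^sub>v (dim_col M)" M] vec_norm2_nonneg order_trans by auto

lemma vec_norm2_mult_le:
  assumes "M \<in> carrier_mat n m" "v \<in> carrier_vec m"
  shows "vec_norm2 (M *\<^sub>v v) \<le> spectral_norm M * vec_norm2 v"
proof (cases "vec_norm2 v = 0")
  case True
  then have "v = 0\<^sub>v m"
    using vec_norm2_eq_0D[of v] assms(2) by simp
  then have "M *\<^sub>v v = 0\<^sub>v n"
    using assms by auto
  then show ?thesis
    using True by simp
next
  case False
  let ?c = "complex_of_real (inverse (vec_norm2 v))"
  have pos: "0 < vec_norm2 v"
    using False vec_norm2_nonneg[of v] by simp
  have "vec_norm2 (M *\<^sub>v (?c \<cdot>\<^sub>v v)) \<le> spectral_norm M"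
    using pos assms by (intro spectral_norm_upper_ball) (auto simp: vec_norm2_smult norm_inverse)
  moreover have "vec_norm2 (M *\<^sub>v (?c \<cdot>\<^sub>v v)) = vec_norm2 (M *\<^sub>v v) / vec_norm2 v"
    unfolding mult_mat_vec[OF assms] vec_norm2_smult
    using pos by (simp add: norm_inverse norm_divide divide_inverse)
  ultimately have "vec_norm2 (M *\<^sub>v v) / vec_norm2 v \<le> spectral_norm M"
    by simp
  then show ?thesis
    using pos by (simp only: pos_divide_le_eq)
qed

lemma spectral_norm_0 [simp]: "spectral_norm (0\<^sub>m n m) = 0"
proof (rule antisym)
  have "0\<^sub>m n m *\<^sub>v v = 0\<^sub>v n" if "v \<in> carrier_vec m" for v :: "complex vec"
    using that by auto
  then show "spectral_norm (0\<^sub>m n m) \<le> 0"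
    by (intro spectral_norm_le[of _ n m]) auto
qed (rule spectral_norm_nonneg)

lemma spectral_norm_mult:
  assumes "M \<in> carrier_mat n m" "N \<in> carrier_mat m l"
  shows "spectral_norm (M * N) \<le> spectral_norm M * spectral_norm N"
proof (rule spectral_norm_le)
  fix v :: "complex vec" assume v: "v \<in> carrier_vec l"
  have "vec_norm2 (M * N *\<^sub>v v) = vec_norm2 (M *\<^sub>v (N *\<^sub>v v))"
    using assms v by simp
  also have "\<dots> \<le> spectral_norm M * vec_norm2 (N *\<^sub>v v)"
    using assms v by (intro vec_norm2_mult_le[of _ n m]) auto
  also have "\<dots> \<le> spectral_norm M * (spectral_norm N * vec_norm2 v)"
    using assms v by (intro mult_left_mono vec_norm2_mult_le[of _ m l] spectral_norm_nonneg)
  finally show "vec_norm2 (M * N *\<^sub>v v) \<le> spectral_norm M * spectral_norm N * vec_norm2 v"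
    by (simp add: mult.assoc)
qed (use assms in \<open>auto simp: spectral_norm_nonneg\<close>)

lemma spectral_norm_triangle:
  assumes "M \<in> carrier_mat n m" "N \<in> carrier_mat n m"
  shows "spectral_norm (M + N) \<le> spectral_norm M + spectral_norm N"
proof (rule spectral_norm_le)
  fix v :: "complex vec" assume v: "v \<in> carrier_vec m"
  have "vec_norm2 ((M + N) *\<^sub>v v) = vec_norm2 (M *\<^sub>v v + N *\<^sub>v v)"
    using assms v by (simp add: add_mult_distrib_mat_vec)
  also have "\<dots> \<le> vec_norm2 (M *\<^sub>v v) + vec_norm2 (N *\<^sub>v v)"
    using assms v by (intro vec_norm2_triangle[of _ n]) auto
  also have "\<dots> \<le> spectral_norm M * vec_norm2 v + spectral_norm N * vec_norm2 v"
    using assms v by (intro add_mono vec_norm2_mult_le[of _ n m])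
  finally show "vec_norm2 ((M + N) *\<^sub>v v) \<le> (spectral_norm M + spectral_norm N) * vec_norm2 v"
    by (simp add: distrib_right)
qed (use assms in \<open>auto simp: spectral_norm_nonneg\<close>)

lemma spectral_norm_uminus:
  "spectral_norm (- M) = spectral_norm M"
proof -
  have "- M *\<^sub>v v = (-1) \<cdot>\<^sub>v (M *\<^sub>v v)" if "v \<in> carrier_vec (dim_col M)" for v
    using that by (intro eq_vecI) (auto simp: scalar_prod_def sum_negf)
  then have "vec_norm2 (- M *\<^sub>v v) = vec_norm2 (M *\<^sub>v v)" if "v \<in> carrier_vec (dim_col M)" for v
    using that by (simp add: vec_norm2_smult)
  then show ?thesis
    unfolding spectral_norm_def by (intro SUP_cong) auto
qed

lemma spectral_norm_triangle_minus:
  assumes "M \<in> carrier_mat n m" "N \<in> carrier_mat n m"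
  shows "spectral_norm (M - N) \<le> spectral_norm M + spectral_norm N"
proof -
  have "M - N = M + - N"
    using assms by auto
  then show ?thesis
    using spectral_norm_triangle[of M n m "- N"] assms by (simp add: spectral_norm_uminus)
qed

text \<open>Move \<open>M\<close> across the inner product in \<open>\<langle>M v, M v\<rangle>\<close>, then apply Cauchy--Schwarz.\<close>

lemma vec_norm2_mult_power2_le:
  assumes M: "M \<in> carrier_mat n m" and v: "v \<in> carrier_vec m"
  shows "(vec_norm2 (M *\<^sub>v v))\<^sup>2 \<le> vec_norm2 v * vec_norm2 (mat_adjoint M *\<^sub>v (M *\<^sub>v v))"
proof -
  have "complex_of_real ((vec_norm2 (M *\<^sub>v v))\<^sup>2) = v \<bullet>c (mat_adjoint M *\<^sub>v (M *\<^sub>v v))"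
    unfolding cscalar_prod_self[symmetric]
    using M v by (intro cscalar_prod_mat_adjoint[of _ n m]) auto
  then have "(vec_norm2 (M *\<^sub>v v))\<^sup>2 = cmod (v \<bullet>c (mat_adjoint M *\<^sub>v (M *\<^sub>v v)))"
    by (metis norm_of_real abs_power2)
  then show ?thesis
    using cscalar_prod_Cauchy_Schwarz[of v "mat_adjoint M *\<^sub>v (M *\<^sub>v v)"] M v by simp
qed

lemma spectral_norm_power2_le:
  "(spectral_norm M)\<^sup>2 \<le> spectral_norm (mat_adjoint M * M)"
proof -
  define n m where "n = dim_row M" and "m = dim_col M"
  have M: "M \<in> carrier_mat n m"
    by (simp add: n_def m_def)
  let ?N = "spectral_norm (mat_adjoint M * M)"
  have "spectral_norm M \<le> sqrt ?N"
  proof (rule spectral_norm_le[OF M])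
    fix v :: "complex vec" assume v: "v \<in> carrier_vec m"
    have "(vec_norm2 (M *\<^sub>v v))\<^sup>2 \<le> vec_norm2 v * vec_norm2 ((mat_adjoint M * M) *\<^sub>v v)"
      using vec_norm2_mult_power2_le[OF M v] M v by (simp add: assoc_mult_mat_vec[of _ m n _ m])
    also have "\<dots> \<le> vec_norm2 v * (?N * vec_norm2 v)"
      using M v by (intro mult_left_mono vec_norm2_mult_le[of _ m m] vec_norm2_nonneg)
        (auto intro: mult_carrier_mat)
    also have "\<dots> = (sqrt ?N * vec_norm2 v)\<^sup>2"
      by (simp add: power2_eq_square spectral_norm_nonneg)
    finally show "vec_norm2 (M *\<^sub>v v) \<le> sqrt ?N * vec_norm2 v"
      by (rule power2_le_imp_le) (simp add: spectral_norm_nonneg vec_norm2_nonneg)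
  qed (simp add: spectral_norm_nonneg)
  then show ?thesis
    using power_mono[of "spectral_norm M" "sqrt ?N" 2] by (simp add: spectral_norm_nonneg)
qed

text \<open>Submultiplicativity turns the inequality \<open>\<parallel>M\<parallel>\<^sup>2 \<le> \<parallel>M\<^sup>* M\<parallel>\<close> into \<open>\<parallel>M\<parallel> \<le> \<parallel>M\<^sup>*\<parallel>\<close>,
  and \<open>M\<^sup>*\<close> may take the place of \<open>M\<close>.\<close>

lemma spectral_norm_mat_adjoint: "spectral_norm (mat_adjoint M) = spectral_norm M"
proof -
  have le: "spectral_norm N \<le> spectral_norm (mat_adjoint N)" for N
  proof (cases "spectral_norm N = 0")
    case True
    then show ?thesis
      by (metis spectral_norm_nonneg)
  next
    case False
    have N: "N \<in> carrier_mat (dim_row N) (dim_col N)"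
      by simp
    have "(spectral_norm N)\<^sup>2 \<le> spectral_norm (mat_adjoint N) * spectral_norm N"
      using spectral_norm_power2_le spectral_norm_mult[OF mat_adjoint_carrier[OF N] N]
      by (rule order_trans)
    then show ?thesis
      using False spectral_norm_nonneg[of N] unfolding power2_eq_square
      by (metis mult_right_le_imp_le order_le_less)
  qed
  show ?thesis
    using le[of M] le[of "mat_adjoint M"] unfolding mat_adjoint_mat_adjoint by (rule antisym[rotated])
qed

lemma spectral_norm_isometry:
  assumes "mat_adjoint V * V = 1\<^sub>m n"
  shows "spectral_norm V \<le> 1"
proof -
  have "spectral_norm (1\<^sub>m n) \<le> 1"
    by (rule spectral_norm_le[of _ n n]) auto
  then have "(spectral_norm V)\<^sup>2 \<le> 1\<^sup>2"
    using spectral_norm_power2_le[of V] assms by simp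
  then show ?thesis
    by (rule power2_le_imp_le) simp
qed

lemma spectral_norm_mat_diag:
  assumes "\<And>i. i < n \<Longrightarrow> cmod (f i) \<le> c" "0 \<le> c"
  shows "spectral_norm (mat_diag n f) \<le> c"
proof (rule spectral_norm_le[of _ n n])
  fix v :: "complex vec" assume v: "v \<in> carrier_vec n"
  have ix: "(mat_diag n f *\<^sub>v v) $ i = f i * v $ i" if "i < n" for i
    using v that
    by (simp add: mat_diag_def scalar_prod_def if_distrib[of "\<lambda>x. x * _"] cong: if_cong)
  have "vec_norm2 (mat_diag n f *\<^sub>v v) = L2_set (\<lambda>i. cmod (f i) * cmod (v $ i)) {..<n}"
    using ix by (auto simp: vec_norm2_def mat_diag_def norm_mult intro!: L2_set_cong)
  also have "\<dots> \<le> L2_set (\<lambda>i. c * cmod (v $ i)) {..<n}"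
    using assms by (intro L2_set_mono mult_right_mono) auto
  also have "\<dots> = c * vec_norm2 v"
    using v assms by (simp add: vec_norm2_def L2_set_right_distrib)
  finally show "vec_norm2 (mat_diag n f *\<^sub>v v) \<le> c * vec_norm2 v" .
qed (use assms in auto)

lemma spectral_norm_mult_left_le:
  assumes "L \<in> carrier_mat n m" "M \<in> carrier_mat m l" "spectral_norm L \<le> c"
  shows "spectral_norm (L * M) \<le> c * spectral_norm M"
  using spectral_norm_mult[OF assms(1,2)] mult_right_mono[OF assms(3) spectral_norm_nonneg] by (rule order_trans)

lemma spectral_norm_mult_right_le:
  assumes "M \<in> carrier_mat n m" "R \<in> carrier_mat m l" "spectral_norm R \<le> c"
  shows "spectral_norm (M * R) \<le> spectral_norm M * c"
  using spectral_norm_mult[OF assms(1,2)] mult_left_mono[OF assms(3) spectral_norm_nonneg] by (rule order_trans)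

lemma spectral_norm_congruence_le:
  assumes L: "L \<in> carrier_mat n m" "spectral_norm L \<le> c" and M: "M \<in> carrier_mat m m"
  shows "spectral_norm (L * M * mat_adjoint L) \<le> c\<^sup>2 * spectral_norm M"
proof -
  have c: "0 \<le> c"
    using L(2) spectral_norm_nonneg[of L] by simp
  have "spectral_norm (L * M * mat_adjoint L) \<le> spectral_norm (L * M) * c"
    using L M by (intro spectral_norm_mult_right_le[of _ n m _ n]) (auto simp: spectral_norm_mat_adjoint)
  also have "\<dots> \<le> c * spectral_norm M * c"
    using L M c by (intro mult_right_mono spectral_norm_mult_left_le[of _ n m _ m]) auto
  finally show ?thesis
    by (simp add: power2_eq_square mult_ac)
qed

section \<open>Block matrices\<close>

text \<open>Associativity with its side conditions on dimensions, where it can serve as a rewrite rule: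
  the inner dimensions need not be guessed by unification.\<close>

lemma assoc_mult_mat_dim:
  fixes A B C :: "complex mat"
  assumes "dim_col A = dim_row B" "dim_col B = dim_row C"
  shows "A * B * C = A * (B * C)"
  using assms by (intro assoc_mult_mat[of A "dim_row A" "dim_col A" B "dim_col B" C "dim_col C"]) auto

lemma four_block_mat_eqD:
  assumes eq: "four_block_mat A B C D = four_block_mat A' B' C' D'"
    and "A \<in> carrier_mat n1 m1" "B \<in> carrier_mat n1 m2" "C \<in> carrier_mat n2 m1" "D \<in> carrier_mat n2 m2"
    and "A' \<in> carrier_mat n1 m1" "B' \<in> carrier_mat n1 m2" "C' \<in> carrier_mat n2 m1" "D' \<in> carrier_mat n2 m2"
  shows "A = A'" "B = B'" "C = C'" "D = D'"
proof -
  have e: "four_block_mat A B C D $$ (i, j) = four_block_mat A' B' C' D' $$ (i, j)" for i j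
    using eq by simp
  show "A = A'"
  proof (rule eq_matI)
    fix i j assume "i < dim_row A'" "j < dim_col A'"
    then show "A $$ (i, j) = A' $$ (i, j)"
      using e[of i j] assms(2-) by simp
  qed (use assms in auto)
  show "B = B'"
  proof (rule eq_matI)
    fix i j assume "i < dim_row B'" "j < dim_col B'"
    then show "B $$ (i, j) = B' $$ (i, j)"
      using e[of i "m1 + j"] assms(2-) by simp
  qed (use assms in auto)
  show "C = C'"
  proof (rule eq_matI)
    fix i j assume "i < dim_row C'" "j < dim_col C'"
    then show "C $$ (i, j) = C' $$ (i, j)"
      using e[of "n1 + i" j] assms(2-) by simp
  qed (use assms in auto)
  show "D = D'"
  proof (rule eq_matI)
    fix i j assume "i < dim_row D'" "j < dim_col D'"
    then show "D $$ (i, j) = D' $$ (i, j)"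
      using e[of "n1 + i" "m1 + j"] assms(2-) by simp
  qed (use assms in auto)
qed

lemma mat_adjoint_four_block_mat:
  fixes A B C D :: "complex mat"
  assumes "A \<in> carrier_mat n1 m1" "B \<in> carrier_mat n1 m2" "C \<in> carrier_mat n2 m1" "D \<in> carrier_mat n2 m2"
  shows "mat_adjoint (four_block_mat A B C D) =
    four_block_mat (mat_adjoint A) (mat_adjoint C) (mat_adjoint B) (mat_adjoint D)"
  by (rule eq_matI) (use assms in auto)

lemma carrier_append_cols [simp, intro]:
  "A \<in> carrier_mat n m1 \<Longrightarrow> B \<in> carrier_mat n m2 \<Longrightarrow> A @\<^sub>c B \<in> carrier_mat n (m1 + m2)"
  unfolding append_cols_def using four_block_carrier_mat[of A n m1 "0\<^sub>m 0 m2" 0 m2] by simp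

lemma mult_append_cols:
  fixes X A B :: "complex mat"
  assumes "X \<in> carrier_mat l n" "A \<in> carrier_mat n m1" "B \<in> carrier_mat n m2"
  shows "X * (A @\<^sub>c B) = X * A @\<^sub>c X * B"
  by (rule eq_matI) (use assms in \<open>auto simp: append_cols_def col_four_block_mat[of A n m1 B m2 _ 0] append_vec_def scalar_prod_def\<close>)

lemma mat_adjoint_append_cols:
  fixes A B :: "complex mat"
  assumes "A \<in> carrier_mat n m1" "B \<in> carrier_mat n m2"
  shows "mat_adjoint (A @\<^sub>c B) = mat_adjoint A @\<^sub>r mat_adjoint B"
  by (rule eq_matI) (use assms in \<open>auto simp: append_cols_def append_rows_def\<close>)

lemma mat_adjoint_append_rows:
  fixes A B :: "complex mat"
  assumes "A \<in> carrier_mat n1 m" "B \<in> carrier_mat n2 m"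
  shows "mat_adjoint (A @\<^sub>r B) = mat_adjoint A @\<^sub>c mat_adjoint B"
  by (rule eq_matI) (use assms in \<open>auto simp: append_cols_def append_rows_def\<close>)

lemma append_cols_mult_append_rows:
  fixes A B C D :: "complex mat"
  assumes "A \<in> carrier_mat n m1" "B \<in> carrier_mat n m2" "C \<in> carrier_mat m1 l" "D \<in> carrier_mat m2 l"
  shows "(A @\<^sub>c B) * (C @\<^sub>r D) = A * C + B * D"
proof -
  have "(A @\<^sub>c B) * (C @\<^sub>r D) = four_block_mat (A * C + B * D) (A * 0\<^sub>m m1 0 + B * 0\<^sub>m m2 0)
      (0\<^sub>m 0 m1 * C + 0\<^sub>m 0 m2 * D) (0\<^sub>m 0 m1 * 0\<^sub>m m1 0 + 0\<^sub>m 0 m2 * 0\<^sub>m m2 0)"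
    unfolding append_cols_def append_rows_def using assms
    by (subst mult_four_block_mat[where ?nr1.0 = n and ?nr2.0 = 0 and ?n1.0 = m1 and ?n2.0 = m2
          and ?nc1.0 = l and ?nc2.0 = 0]) auto
  also have "\<dots> = A * C + B * D"
    by (rule eq_matI) (use assms in auto)
  finally show ?thesis .
qed

lemma append_rows_mult_append_cols:
  fixes A B C D :: "complex mat"
  assumes "A \<in> carrier_mat n1 m" "B \<in> carrier_mat n2 m" "C \<in> carrier_mat m l1" "D \<in> carrier_mat m l2"
  shows "(A @\<^sub>r B) * (C @\<^sub>c D) = four_block_mat (A * C) (A * D) (B * C) (B * D)"
proof -
  have "(A @\<^sub>r B) * (C @\<^sub>c D) = four_block_mat (A * C + 0\<^sub>m n1 0 * 0\<^sub>m 0 l1) (A * D + 0\<^sub>m n1 0 * 0\<^sub>m 0 l2)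
      (B * C + 0\<^sub>m n2 0 * 0\<^sub>m 0 l1) (B * D + 0\<^sub>m n2 0 * 0\<^sub>m 0 l2)"
    unfolding append_cols_def append_rows_def using assms
    by (subst mult_four_block_mat[where ?nr1.0 = n1 and ?nr2.0 = n2 and ?n1.0 = m and ?n2.0 = 0
          and ?nc1.0 = l1 and ?nc2.0 = l2]) auto
  also have "\<dots> = four_block_mat (A * C) (A * D) (B * C) (B * D)"
    by (rule eq_matI) (use assms in \<open>auto simp: scalar_prod_def\<close>)
  finally show ?thesis .
qed

lemma append_cols_mult_block_diag:
  fixes A B S T :: "complex mat"
  assumes "A \<in> carrier_mat n m1" "B \<in> carrier_mat n m2" "S \<in> carrier_mat m1 l1" "T \<in> carrier_mat m2 l2"
  shows "(A @\<^sub>c B) * four_block_mat S (0\<^sub>m m1 l2) (0\<^sub>m m2 l1) T = A * S @\<^sub>c B * T"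
proof -
  have "(A @\<^sub>c B) * four_block_mat S (0\<^sub>m m1 l2) (0\<^sub>m m2 l1) T =
    four_block_mat (A * S + B * 0\<^sub>m m2 l1) (A * 0\<^sub>m m1 l2 + B * T)
     (0\<^sub>m 0 m1 * S + 0\<^sub>m 0 m2 * 0\<^sub>m m2 l1) (0\<^sub>m 0 m1 * 0\<^sub>m m1 l2 + 0\<^sub>m 0 m2 * T)"
    unfolding append_cols_def using assms
    by (subst mult_four_block_mat[where ?nr1.0 = n and ?nr2.0 = 0 and ?n1.0 = m1 and ?n2.0 = m2
          and ?nc1.0 = l1 and ?nc2.0 = l2]) auto
  also have "\<dots> = A * S @\<^sub>c B * T"
    by (rule eq_matI) (use assms in \<open>auto simp: append_cols_def\<close>)
  finally show ?thesis .
qed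

text \<open>The two unitarity equations of a matrix with two column blocks, read block by block.\<close>

lemma unitary_append_cols:
  assumes V: "unitary_mat n (V1 @\<^sub>c V2)"
    and V1: "V1 \<in> carrier_mat n m1" and V2: "V2 \<in> carrier_mat n m2"
    and n: "n = m1 + m2"
  shows "mat_adjoint V1 * V1 = 1\<^sub>m m1" "mat_adjoint V1 * V2 = 0\<^sub>m m1 m2"
    "mat_adjoint V2 * V1 = 0\<^sub>m m2 m1" "mat_adjoint V2 * V2 = 1\<^sub>m m2"
    "V1 * mat_adjoint V1 + V2 * mat_adjoint V2 = 1\<^sub>m n"
proof -
  have "four_block_mat (mat_adjoint V1 * V1) (mat_adjoint V1 * V2) (mat_adjoint V2 * V1) (mat_adjoint V2 * V2)
    = mat_adjoint (V1 @\<^sub>c V2) * (V1 @\<^sub>c V2)"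
    unfolding mat_adjoint_append_cols[OF V1 V2] using V1 V2
    by (intro append_rows_mult_append_cols[symmetric]) auto
  also have "\<dots> = four_block_mat (1\<^sub>m m1) (0\<^sub>m m1 m2) (0\<^sub>m m2 m1) (1\<^sub>m m2)"
    using V n by (simp add: unitary_mat_def)
  finally have eq: "four_block_mat (mat_adjoint V1 * V1) (mat_adjoint V1 * V2) (mat_adjoint V2 * V1) (mat_adjoint V2 * V2)
    = four_block_mat (1\<^sub>m m1) (0\<^sub>m m1 m2) (0\<^sub>m m2 m1) (1\<^sub>m m2)" .
  note V1' = mat_adjoint_carrier[OF V1] and V2' = mat_adjoint_carrier[OF V2]
  note blocks = four_block_mat_eqD[OF eq mult_carrier_mat[OF V1' V1] mult_carrier_mat[OF V1' V2]
      mult_carrier_mat[OF V2' V1] mult_carrier_mat[OF V2' V2]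
      one_carrier_mat zero_carrier_mat zero_carrier_mat one_carrier_mat]
  show "mat_adjoint V1 * V1 = 1\<^sub>m m1" "mat_adjoint V1 * V2 = 0\<^sub>m m1 m2"
    "mat_adjoint V2 * V1 = 0\<^sub>m m2 m1" "mat_adjoint V2 * V2 = 1\<^sub>m m2"
    by (rule blocks)+
  have "V1 * mat_adjoint V1 + V2 * mat_adjoint V2 = (V1 @\<^sub>c V2) * mat_adjoint (V1 @\<^sub>c V2)"
    unfolding mat_adjoint_append_cols[OF V1 V2] using V1 V2
    by (intro append_cols_mult_append_rows[symmetric]) auto
  then show "V1 * mat_adjoint V1 + V2 * mat_adjoint V2 = 1\<^sub>m n"
    using V by (simp add: unitary_mat_def)
qed

lemma append_cols_split:
  fixes V :: "complex mat"
  assumes "V \<in> carrier_mat n (m1 + m2)"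
  obtains V1 V2 where "V1 \<in> carrier_mat n m1" "V2 \<in> carrier_mat n m2" "V = V1 @\<^sub>c V2"
proof
  show "mat n m1 (\<lambda>ij. V $$ ij) \<in> carrier_mat n m1"
    and "mat n m2 (\<lambda>(i, j). V $$ (i, m1 + j)) \<in> carrier_mat n m2" by simp_all
  show "V = mat n m1 (\<lambda>ij. V $$ ij) @\<^sub>c mat n m2 (\<lambda>(i, j). V $$ (i, m1 + j))"
    by (rule eq_matI) (use assms in \<open>auto simp: append_cols_def\<close>)
qed

section \<open>Diagonal blocks of Lyapunov equations\<close>

text \<open>Because the Gramian is block diagonal, the off-diagonal blocks of \<open>A\<close> do not reach the
  diagonal blocks of the Lyapunov equation: its trailing block is a Lyapunov equation for \<open>A22\<close>.\<close>

lemma lyapunov_trailing_block: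
  fixes A11 A12 A21 A22 B1 B2 S T :: "complex mat"
  assumes A: "A11 \<in> carrier_mat l l" "A12 \<in> carrier_mat l r" "A21 \<in> carrier_mat r l" "A22 \<in> carrier_mat r r"
    and B: "B1 \<in> carrier_mat l m" "B2 \<in> carrier_mat r m"
    and S: "S \<in> carrier_mat l l" and T: "T \<in> carrier_mat r r"
    and eq: "four_block_mat A11 A12 A21 A22 * four_block_mat S (0\<^sub>m l r) (0\<^sub>m r l) T +
      four_block_mat S (0\<^sub>m l r) (0\<^sub>m r l) T * mat_adjoint (four_block_mat A11 A12 A21 A22) +
      (B1 @\<^sub>r B2) * mat_adjoint (B1 @\<^sub>r B2) = 0\<^sub>m (l + r) (l + r)"
  shows "A22 * T + T * mat_adjoint A22 + B2 * mat_adjoint B2 = 0\<^sub>m r r"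
proof -
  have 1: "four_block_mat A11 A12 A21 A22 * four_block_mat S (0\<^sub>m l r) (0\<^sub>m r l) T =
      four_block_mat (A11 * S) (A12 * T) (A21 * S) (A22 * T)"
    using A S T by (subst mult_four_block_mat[where ?nr1.0 = l and ?nr2.0 = r and ?n1.0 = l and ?n2.0 = r
          and ?nc1.0 = l and ?nc2.0 = r]) auto
  have 2: "four_block_mat S (0\<^sub>m l r) (0\<^sub>m r l) T * mat_adjoint (four_block_mat A11 A12 A21 A22) =
      four_block_mat (S * mat_adjoint A11) (S * mat_adjoint A21) (T * mat_adjoint A12) (T * mat_adjoint A22)"
    unfolding mat_adjoint_four_block_mat[OF A]
    using A S T by (subst mult_four_block_mat[where ?nr1.0 = l and ?nr2.0 = r and ?n1.0 = l and ?n2.0 = r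
          and ?nc1.0 = l and ?nc2.0 = r]) auto
  have 3: "(B1 @\<^sub>r B2) * mat_adjoint (B1 @\<^sub>r B2) =
      four_block_mat (B1 * mat_adjoint B1) (B1 * mat_adjoint B2) (B2 * mat_adjoint B1) (B2 * mat_adjoint B2)"
    unfolding mat_adjoint_append_rows[OF B]
    using B by (intro append_rows_mult_append_cols) auto
  have "four_block_mat (A11 * S + S * mat_adjoint A11 + B1 * mat_adjoint B1)
      (A12 * T + S * mat_adjoint A21 + B1 * mat_adjoint B2)
      (A21 * S + T * mat_adjoint A12 + B2 * mat_adjoint B1)
      (A22 * T + T * mat_adjoint A22 + B2 * mat_adjoint B2) =
      four_block_mat (0\<^sub>m l l) (0\<^sub>m l r) (0\<^sub>m r l) (0\<^sub>m r r)"
    using eq unfolding 1 2 3 four_block_zero_mat using A B S T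
    by (subst (asm) add_four_block_mat[where ?nr1.0 = l and ?nr2.0 = r and ?nc1.0 = l and ?nc2.0 = r],
        auto)
      (subst (asm) add_four_block_mat[where ?nr1.0 = l and ?nr2.0 = r and ?nc1.0 = l and ?nc2.0 = r],
        auto)
  then show ?thesis
    by (rule four_block_mat_eqD(4)[where ?n1.0 = l and ?n2.0 = r and ?m1.0 = l and ?m2.0 = r])
      (use A B S T in auto)
qed

section \<open>Two Lyapunov equations with nearly scalar Gramian\<close>

text \<open>Subtracting the two Lyapunov equations gives \<open>X - Y = [T, A - A\<^sup>*]\<close>. A scalar matrix commutes
  with everything, so \<open>T\<close> may be replaced by its deviation \<open>E\<close> from any multiple \<open>c I\<close> of the
  identity, and the commutator is small when \<open>T\<close> is close to such a multiple.\<close>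

lemma gramian_gap_commutator:
  fixes A X Y :: "complex mat" and f :: "nat \<Rightarrow> real" and r :: nat and c :: real
  defines "T \<equiv> mat_diag r (\<lambda>i. complex_of_real (f i))"
  assumes A: "A \<in> carrier_mat r r" and X: "X \<in> carrier_mat r r" and Y: "Y \<in> carrier_mat r r"
    and ctrl: "A * T + T * mat_adjoint A + X = 0\<^sub>m r r"
    and obs: "mat_adjoint A * T + T * A + Y = 0\<^sub>m r r"
  defines "E \<equiv> mat_diag r (\<lambda>i. complex_of_real (f i - c))" and "H \<equiv> A - mat_adjoint A"
  shows "X - Y = E * H - H * E"
proof (rule eq_matI)
  have A': "mat_adjoint A \<in> carrier_mat r r" and H: "H \<in> carrier_mat r r"
    using A by (auto simp: H_def intro!: minus_carrier_mat)
  note diag = mat_diag_mult_left[OF A] mat_diag_mult_left[OF A'] mat_diag_mult_right[OF A]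
    mat_diag_mult_right[OF A'] mat_diag_mult_left[OF H] mat_diag_mult_right[OF H]
  fix i j assume "i < dim_row (E * H - H * E)" "j < dim_col (E * H - H * E)"
  then have ij: "i < r" "j < r"
    using A by (simp_all add: E_def mat_diag_def H_def)
  have "(A * T + T * mat_adjoint A + X) $$ (i, j) = 0" "(mat_adjoint A * T + T * A + Y) $$ (i, j) = 0"
    using ij ctrl obs by simp_all
  then have x: "X $$ (i, j) = - (A $$ (i, j) * f j + f i * cnj (A $$ (j, i)))"
    and y: "Y $$ (i, j) = - (cnj (A $$ (j, i)) * f j + f i * A $$ (i, j))"
    using ij A X Y by (auto simp: T_def diag add_eq_0_iff2)
  have "(X - Y) $$ (i, j) = X $$ (i, j) - Y $$ (i, j)"
    using ij Y by simp
  also have "\<dots> = (f i - c) * (A $$ (i, j) - cnj (A $$ (j, i))) - (A $$ (i, j) - cnj (A $$ (j, i))) * (f j - c)"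
    unfolding x y by (simp add: algebra_simps)
  also have "\<dots> = (E * H - H * E) $$ (i, j)"
    using ij A by (simp add: E_def diag) (simp add: H_def)
  finally show "(X - Y) $$ (i, j) = (E * H - H * E) $$ (i, j)" .
qed (use A Y in \<open>auto simp: E_def H_def mat_diag_def\<close>)

lemma gramian_gap_norm:
  fixes A X Y :: "complex mat" and f :: "nat \<Rightarrow> real" and r :: nat
  defines "T \<equiv> mat_diag r (\<lambda>i. complex_of_real (f i))"
  assumes A: "A \<in> carrier_mat r r" and X: "X \<in> carrier_mat r r" and Y: "Y \<in> carrier_mat r r"
    and ctrl: "A * T + T * mat_adjoint A + X = 0\<^sub>m r r"
    and obs: "mat_adjoint A * T + T * A + Y = 0\<^sub>m r r"
    and f: "\<And>i. i < r \<Longrightarrow> \<bar>f i - c\<bar> \<le> \<epsilon>" and eps: "0 \<le> \<epsilon>"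
  shows "spectral_norm (X - Y) \<le> 4 * \<epsilon> * spectral_norm A"
proof -
  define E where "E = mat_diag r (\<lambda>i. complex_of_real (f i - c))"
  define H where "H = A - mat_adjoint A"
  have H: "H \<in> carrier_mat r r"
    using A by (auto simp: H_def intro!: minus_carrier_mat)
  have E: "E \<in> carrier_mat r r"
    by (simp add: E_def)
  have nE: "spectral_norm E \<le> \<epsilon>"
    unfolding E_def using f eps by (intro spectral_norm_mat_diag) (simp_all only: norm_of_real)
  have nH: "spectral_norm H \<le> 2 * spectral_norm A"
    unfolding H_def using A
    by (intro order_trans[OF spectral_norm_triangle_minus[of _ r r]]) (auto simp: spectral_norm_mat_adjoint)
  have "X - Y = E * H - H * E"
    unfolding E_def H_def using A X Y ctrl obs unfolding T_def by (rule gramian_gap_commutator)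
  then have "spectral_norm (X - Y) \<le> spectral_norm (E * H) + spectral_norm (H * E)"
    using E H by (auto intro!: spectral_norm_triangle_minus[of _ r r])
  also have "\<dots> \<le> \<epsilon> * spectral_norm H + spectral_norm H * \<epsilon>"
    by (intro add_mono spectral_norm_mult_left_le[OF E H nE] spectral_norm_mult_right_le[OF H E nE])
  also have "\<dots> = 2 * \<epsilon> * spectral_norm H"
    by simp
  also have "\<dots> \<le> 2 * \<epsilon> * (2 * spectral_norm A)"
    using eps nH by (intro mult_left_mono) auto
  finally show ?thesis
    by simp
qed

text \<open>The second entry \<open>A - A\<^sup>*\<close> of the commutator vanishes.\<close>

lemma gramian_gap_hermitian:
  fixes A X Y :: "complex mat" and f :: "nat \<Rightarrow> real" and r :: nat
  defines "T \<equiv> mat_diag r (\<lambda>i. complex_of_real (f i))"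
  assumes A: "A \<in> carrier_mat r r" and X: "X \<in> carrier_mat r r" and Y: "Y \<in> carrier_mat r r"
    and ctrl: "A * T + T * mat_adjoint A + X = 0\<^sub>m r r"
    and obs: "mat_adjoint A * T + T * A + Y = 0\<^sub>m r r"
    and herm: "hermitian_mat A"
  shows "X - Y = 0\<^sub>m r r"
proof -
  have "A - mat_adjoint A = 0\<^sub>m r r"
    using A herm by (simp add: hermitian_mat_def)
  then show ?thesis
    using gramian_gap_commutator[of A r X Y f 0] A X Y ctrl obs unfolding T_def
    by (simp add: right_mult_zero_mat[OF mat_diag_dim] left_mult_zero_mat[OF mat_diag_dim])
qed

section \<open>Singular values from a singular value decomposition\<close>

lemma proots_prod_linear_factors:
  fixes a :: "nat \<Rightarrow> 'a :: idom"
  shows "proots (\<Prod>i<n. [:- a i, 1:]) = mset (map a [0..<n])"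
proof (induction n)
  case (Suc n)
  have "proots (\<Prod>i<Suc n. [:- a i, 1:]) = proots (\<Prod>i<n. [:- a i, 1:]) + proots [:- a n, 1:]"
    unfolding prod.lessThan_Suc by (rule proots_mult) simp_all
  then show ?case
    unfolding Suc by simp
qed simp

text \<open>The characteristic polynomial determines the multiset of the squares, nonnegativity removes
  the square, and a decreasing list is determined by its multiset.\<close>

lemma sqrt_eigenvalues_unique:
  assumes "sqrt_eigenvalues M s" "sqrt_eigenvalues M t" and i: "i \<in> {1..dim_row M}"
  shows "s i = t i"
proof -
  define n where "n = dim_row M"
  define xs where "xs u = map (\<lambda>i. u (Suc i)) [0..<n]" for u :: "nat \<Rightarrow> real"
  have mset: "mset (xs u) = image_mset (\<lambda>z. sqrt (Re z)) (proots (char_poly M))"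
    and sorted: "sorted (rev (xs u))" if u: "sqrt_eigenvalues M u" for u
  proof -
    have nonneg: "0 \<le> u (Suc i)" if "i < n" for i
      using u that by (auto simp: sqrt_eigenvalues_def n_def)
    have "char_poly M = (\<Prod>i<n. [:- complex_of_real ((u (Suc i))\<^sup>2), 1:])"
      using u prod.atLeast1_atMost_eq[of "\<lambda>i. [:- complex_of_real ((u i)\<^sup>2), 1:]" n]
      by (simp add: sqrt_eigenvalues_def n_def)
    then have "proots (char_poly M) = mset (map (\<lambda>i. complex_of_real ((u (Suc i))\<^sup>2)) [0..<n])"
      by (simp only: proots_prod_linear_factors)
    then have "image_mset (\<lambda>z. sqrt (Re z)) (proots (char_poly M)) =
        mset (map (\<lambda>i. sqrt (Re (complex_of_real ((u (Suc i))\<^sup>2)))) [0..<n])"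
      by (simp only: mset_map[symmetric] map_map o_def)
    also have "map (\<lambda>i. sqrt (Re (complex_of_real ((u (Suc i))\<^sup>2)))) [0..<n] = xs u"
      unfolding xs_def by (rule map_cong) (use nonneg in \<open>simp_all only: Re_complex_of_real real_sqrt_abs abs_of_nonneg set_upt atLeastLessThan_iff\<close>)
    finally show "mset (xs u) = image_mset (\<lambda>z. sqrt (Re z)) (proots (char_poly M))" ..
    show "sorted (rev (xs u))"
      using u by (auto simp: sorted_rev_iff_nth_mono xs_def sqrt_eigenvalues_def n_def)
  qed
  have "rev (xs s) = rev (xs t)"
    using mset sorted assms by (metis mset_rev properties_for_sort)
  then have "xs s ! (i - 1) = xs t ! (i - 1)"
    by simp
  then show ?thesis
    using i by (auto simp: xs_def n_def)
qed

text \<open>With \<open>M\<^sup>* = U S V\<^sup>*\<close> one has \<open>M M\<^sup>* = V (S\<^sup>* S) V\<^sup>*\<close>, so the squares of the diagonal of \<open>S\<close>,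
  followed by zeros, are the eigenvalues of \<open>M M\<^sup>*\<close>.\<close>

lemma svd_singular_values:
  assumes M: "M \<in> carrier_mat p r" and s: "singular_values M s" and svd: "is_svd (mat_adjoint M) U S V"
    and i: "i < min r p"
  shows "S $$ (i, i) = complex_of_real (s (Suc i))"
proof -
  note M' = mat_adjoint_carrier[OF M]
  have U: "unitary_mat r U" and V: "unitary_mat p V" and S: "S \<in> carrier_mat r p"
    and eq: "mat_adjoint M = U * S * mat_adjoint V"
    using svd M by (simp_all add: is_svd_def)
  obtain d where d: "\<forall>i < min r p. 0 \<le> d i" "\<forall>i j. i \<le> j \<longrightarrow> j < min r p \<longrightarrow> d j \<le> d i"
    and Sd: "\<forall>i < r. \<forall>j < p. S $$ (i, j) = (if i = j then complex_of_real (d i) else 0)"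
    using svd M by (auto simp: is_svd_def)
  define g where "g i = (if i < min r p then d i else 0)" for i
  have car: "U \<in> carrier_mat r r" "V \<in> carrier_mat p p" and UU: "mat_adjoint U * U = 1\<^sub>m r"
    using U V by (auto simp: unitary_mat_def)
  have "M * mat_adjoint M = mat_adjoint (mat_adjoint M) * mat_adjoint M" by simp
  also have "\<dots> = V * mat_adjoint S * mat_adjoint U * (U * S * mat_adjoint V)"
    unfolding eq using car S by (simp add: mat_adjoint_mult assoc_mult_mat_dim)
  also have "\<dots> = V * (mat_adjoint S * ((mat_adjoint U * U) * (S * mat_adjoint V)))"
    using car S by (simp add: assoc_mult_mat_dim)
  also have "\<dots> = V * (mat_adjoint S * S) * mat_adjoint V"
    unfolding UU using car S by (simp add: assoc_mult_mat_dim)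
  also have "mat_adjoint S * S = mat_diag p (\<lambda>i. complex_of_real ((g i)\<^sup>2))"
  proof (rule eq_matI)
    fix a b assume "a < dim_row (mat_diag p (\<lambda>i. complex_of_real ((g i)\<^sup>2)))"
      "b < dim_col (mat_diag p (\<lambda>i. complex_of_real ((g i)\<^sup>2)))"
    then have ab: "a < p" "b < p"
      by (simp_all add: mat_diag_def)
    have "(mat_adjoint S * S) $$ (a, b) = (\<Sum>k = 0..<r. cnj (S $$ (k, a)) * S $$ (k, b))"
      using ab S by (simp add: scalar_prod_def)
    also have "\<dots> = (\<Sum>k = 0..<r. if k = a then (if a = b then complex_of_real ((d a)\<^sup>2) else 0) else 0)"
      by (rule sum.cong) (use ab Sd in \<open>auto simp: power2_eq_square\<close>)
    also have "\<dots> = mat_diag p (\<lambda>i. complex_of_real ((g i)\<^sup>2)) $$ (a, b)"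
      using ab by (auto simp: sum.delta mat_diag_def g_def)
    finally show "(mat_adjoint S * S) $$ (a, b) = mat_diag p (\<lambda>i. complex_of_real ((g i)\<^sup>2)) $$ (a, b)" .
  qed (use S in \<open>auto simp: mat_diag_def\<close>)
  finally have "similar_mat (M * mat_adjoint M) (mat_diag p (\<lambda>i. complex_of_real ((g i)\<^sup>2)))"
    using M M' V by (intro similar_matI[where n = p and P = V and Q = "mat_adjoint V"])
      (auto simp: unitary_mat_def intro!: mult_carrier_mat)
  then have "char_poly (M * mat_adjoint M) = char_poly (mat_diag p (\<lambda>i. complex_of_real ((g i)\<^sup>2)))"
    by (rule char_poly_similar)
  also have "\<dots> = (\<Prod>a\<leftarrow>diag_mat (mat_diag p (\<lambda>i. complex_of_real ((g i)\<^sup>2))). [:- a, 1:])"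
    by (rule char_poly_upper_triangular[OF mat_diag_dim]) (auto simp: upper_triangular_def mat_diag_def)
  also have "\<dots> = (\<Prod>i\<leftarrow>[0..<p]. [:- complex_of_real ((g i)\<^sup>2), 1:])"
    by (rule arg_cong[of _ _ prod_list]) (auto simp: diag_mat_def mat_diag_def)
  also have "\<dots> = (\<Prod>i<p. [:- complex_of_real ((g i)\<^sup>2), 1:])"
    by (simp add: prod.distinct_set_conv_list[symmetric] lessThan_atLeast0)
  also have "\<dots> = (\<Prod>i\<in>{1..p}. [:- complex_of_real ((g (i - 1))\<^sup>2), 1:])"
    using prod.atLeast1_atMost_eq[of "\<lambda>i. [:- complex_of_real ((g (i - 1))\<^sup>2), 1:]" p] by simp
  finally have "sqrt_eigenvalues (M * mat_adjoint M) (\<lambda>i. g (i - 1))"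
    using M d by (auto simp: sqrt_eigenvalues_def g_def)
  then have "s (Suc i) = g (Suc i - 1)"
    using s M i by (intro sqrt_eigenvalues_unique[of "M * mat_adjoint M"]) (auto simp: singular_values_def)
  then show ?thesis
    using Sd i by (simp add: g_def)
qed

section \<open>The matrix built from a truncated singular value decomposition\<close>

lemma invertible_mat_diag_inverse:
  fixes g :: "nat \<Rightarrow> real"
  assumes inv: "invertible_mat (mat_diag n (\<lambda>i. complex_of_real (g i)))"
  shows "the (mat_inverse (mat_diag n (\<lambda>i. complex_of_real (g i)))) = mat_diag n (\<lambda>i. complex_of_real (inverse (g i)))"
    and "\<And>i. i < n \<Longrightarrow> g i \<noteq> 0"
proof -
  let ?D = "mat_diag n (\<lambda>i. complex_of_real (g i))"
  obtain W where "inverts_mat ?D W" "inverts_mat W ?D"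
    using inv by (auto simp: invertible_mat_def)
  then have W: "?D * W = 1\<^sub>m n" "W * ?D = 1\<^sub>m (dim_row W)"
    by (simp_all add: inverts_mat_def mat_diag_def)
  have "dim_row W = n" "dim_col W = n"
    using arg_cong[OF W(1), of dim_col] arg_cong[OF W(2), of dim_col] by (simp_all add: mat_diag_def)
  then have car: "W \<in> carrier_mat n n"
    by (rule carrier_matI)
  have ix: "g i * X $$ (i, j) = (if i = j then 1 else 0)"
    if "?D * X = 1\<^sub>m n" "X \<in> carrier_mat n n" "i < n" "j < n" for X i j
    using arg_cong[OF that(1), of "\<lambda>M. M $$ (i, j)"] that(3,4) by (simp add: mat_diag_mult_left[OF that(2)])
  show nz: "g i \<noteq> 0" if "i < n" for i
    using ix[OF W(1) car that that] by auto
  have "mat_inverse ?D \<noteq> None"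
  proof
    assume "mat_inverse ?D = None"
    then have "?D \<notin> Units (ring_mat TYPE(complex) n ())"
      by (rule mat_inverse(1)[OF mat_diag_dim])
    moreover have "W * ?D = 1\<^sub>m n"
      using W(2) \<open>dim_row W = n\<close> by simp
    ultimately show False
      unfolding Units_def ring_mat_simps using W(1) car mat_diag_dim by blast
  qed
  then obtain V where V: "mat_inverse ?D = Some V"
    by blast
  note V' = mat_inverse(2)[OF mat_diag_dim V]
  have "V = mat_diag n (\<lambda>i. complex_of_real (inverse (g i)))"
  proof (rule eq_matI)
    fix i j assume "i < dim_row (mat_diag n (\<lambda>i. complex_of_real (inverse (g i))))"
      "j < dim_col (mat_diag n (\<lambda>i. complex_of_real (inverse (g i))))"
    then have ij: "i < n" "j < n"
      by (simp_all add: mat_diag_def)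
    have "g i * V $$ (i, j) = (if i = j then 1 else 0)"
      using V' ij by (intro ix) auto
    then show "V $$ (i, j) = mat_diag n (\<lambda>i. complex_of_real (inverse (g i))) $$ (i, j)"
      using ij nz[of i] by (auto simp: mat_diag_def field_simps split: if_splits)
  qed (use V' in \<open>auto simp: mat_diag_def\<close>)
  then show "the (mat_inverse ?D) = mat_diag n (\<lambda>i. complex_of_real (inverse (g i)))"
    by (simp add: V)
qed

text \<open>Conjugating \<open>M M\<^sup>*\<close> by the unitary left factor gives \<open>S S\<^sup>*\<close>, which is block diagonal;
  these are its two diagonal blocks.\<close>

lemma svd_compressed_grams:
  assumes M: "M = (U1 @\<^sub>c U2) * four_block_mat S1 (0\<^sub>m q (p - q)) (0\<^sub>m (r - q) q) S2 * mat_adjoint V"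
    and U: "unitary_mat r (U1 @\<^sub>c U2)" and V: "unitary_mat p V" and q: "q \<le> r" "q \<le> p"
    and U1: "U1 \<in> carrier_mat r q" and U2: "U2 \<in> carrier_mat r (r - q)"
    and S1: "S1 \<in> carrier_mat q q" and S2: "S2 \<in> carrier_mat (r - q) (p - q)"
  shows "mat_adjoint U1 * (M * mat_adjoint M) * U1 = S1 * mat_adjoint S1"
    and "mat_adjoint U2 * (M * mat_adjoint M) * U2 = S2 * mat_adjoint S2"
proof -
  let ?U = "U1 @\<^sub>c U2" and ?S = "four_block_mat S1 (0\<^sub>m q (p - q)) (0\<^sub>m (r - q) q) S2"
  have Uc: "?U \<in> carrier_mat r r" and Vc: "V \<in> carrier_mat p p"
    and UU: "mat_adjoint ?U * ?U = 1\<^sub>m r" and VV: "mat_adjoint V * V = 1\<^sub>m p"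
    using U V by (auto simp: unitary_mat_def)
  have Sc: "?S \<in> carrier_mat r p"
    using four_block_carrier_mat[OF S1 S2] q by simp
  have Mc: "M \<in> carrier_mat r p"
    unfolding M using Uc Vc Sc by (auto intro!: mult_carrier_mat)
  have "mat_adjoint ?U * M = (mat_adjoint ?U * ?U) * (?S * mat_adjoint V)"
    unfolding M using Uc Vc Sc by (simp add: assoc_mult_mat_dim del: index_mat_four_block)
  then have UM: "mat_adjoint ?U * M = ?S * mat_adjoint V"
    unfolding UU left_mult_one_mat[OF mult_carrier_mat[OF Sc mat_adjoint_carrier[OF Vc]]] .
  have "mat_adjoint ?U * (M * mat_adjoint M) * ?U = (mat_adjoint ?U * M) * mat_adjoint (mat_adjoint ?U * M)"
    using Uc Mc by (simp add: assoc_mult_mat_dim mat_adjoint_mult)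
  also have "\<dots> = ?S * ((mat_adjoint V * V) * mat_adjoint ?S)"
    unfolding UM using Vc carrier_matD[OF Sc]
    by (simp add: assoc_mult_mat_dim mat_adjoint_mult del: index_mat_four_block)
  also have "\<dots> = ?S * mat_adjoint ?S"
    unfolding VV using left_mult_one_mat[OF mat_adjoint_carrier[OF Sc]] by simp
  also have "mat_adjoint ?S = four_block_mat (mat_adjoint S1) (0\<^sub>m q (r - q)) (0\<^sub>m (p - q) q) (mat_adjoint S2)"
    using S1 S2 by (subst mat_adjoint_four_block_mat[where ?n1.0 = q and ?n2.0 = "r - q" and ?m1.0 = q and ?m2.0 = "p - q"])
      (auto intro!: cong_four_block_mat eq_matI)
  also have "?S * four_block_mat (mat_adjoint S1) (0\<^sub>m q (r - q)) (0\<^sub>m (p - q) q) (mat_adjoint S2) =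
      four_block_mat (S1 * mat_adjoint S1) (0\<^sub>m q (r - q)) (0\<^sub>m (r - q) q) (S2 * mat_adjoint S2)"
    using S1 S2 by (subst mult_four_block_mat[where ?nr1.0 = q and ?nr2.0 = "r - q" and ?n1.0 = q
          and ?n2.0 = "p - q" and ?nc1.0 = q and ?nc2.0 = "r - q"]) (auto intro!: cong_four_block_mat)
  finally have rhs: "mat_adjoint ?U * (M * mat_adjoint M) * ?U =
      four_block_mat (S1 * mat_adjoint S1) (0\<^sub>m q (r - q)) (0\<^sub>m (r - q) q) (S2 * mat_adjoint S2)" .
  let ?N = "M * mat_adjoint M"
  have N: "?N \<in> carrier_mat r r"
    using Mc by (auto intro!: mult_carrier_mat)
  have "mat_adjoint ?U * ?N * ?U = mat_adjoint ?U * (?N * U1 @\<^sub>c ?N * U2)"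
    using Uc N by (subst mult_append_cols[OF N U1 U2, symmetric]) (auto intro: assoc_mult_mat)
  also have "\<dots> = four_block_mat (mat_adjoint U1 * (?N * U1)) (mat_adjoint U1 * (?N * U2))
      (mat_adjoint U2 * (?N * U1)) (mat_adjoint U2 * (?N * U2))"
    unfolding mat_adjoint_append_cols[OF U1 U2]
    by (rule append_rows_mult_append_cols[OF mat_adjoint_carrier[OF U1] mat_adjoint_carrier[OF U2]
        mult_carrier_mat[OF N U1] mult_carrier_mat[OF N U2]])
  finally have lhs: "four_block_mat (mat_adjoint U1 * (?N * U1)) (mat_adjoint U1 * (?N * U2))
      (mat_adjoint U2 * (?N * U1)) (mat_adjoint U2 * (?N * U2)) =
      four_block_mat (S1 * mat_adjoint S1) (0\<^sub>m q (r - q)) (0\<^sub>m (r - q) q) (S2 * mat_adjoint S2)"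
    using rhs by simp
  note A1 = mat_adjoint_carrier[OF U1] and A2 = mat_adjoint_carrier[OF U2]
  note N1 = mult_carrier_mat[OF N U1] and N2 = mult_carrier_mat[OF N U2]
  note blocks = four_block_mat_eqD[OF lhs mult_carrier_mat[OF A1 N1] mult_carrier_mat[OF A1 N2]
      mult_carrier_mat[OF A2 N1] mult_carrier_mat[OF A2 N2]
      mult_carrier_mat[OF S1 mat_adjoint_carrier[OF S1]] zero_carrier_mat zero_carrier_mat
      mult_carrier_mat[OF S2 mat_adjoint_carrier[OF S2]]]
  show "mat_adjoint U1 * ?N * U1 = S1 * mat_adjoint S1" "mat_adjoint U2 * ?N * U2 = S2 * mat_adjoint S2"
    using blocks(1,4) assoc_mult_mat[OF A1 N U1] assoc_mult_mat[OF A2 N U2] by simp_all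
qed

text \<open>The unitary factor \<open>V\<close> cancels, so that the product is
  \<open>M V X\<^sup>* = U1 S1 X1\<^sup>* + U2 S2 X2\<^sup>*\<close>. By the choice of \<open>X1\<close> the first term is \<open>- U1 U1\<^sup>* B\<close>, and it
  cancels the component of \<open>B = U1 U1\<^sup>* B + U2 U2\<^sup>* B\<close> in the range of \<open>U1\<close>.\<close>

lemma truncated_svd_residual:
  assumes M: "M = (U1 @\<^sub>c U2) * four_block_mat S1 (0\<^sub>m q (p - q)) (0\<^sub>m (r - q) q) S2 * mat_adjoint V"
    and U: "unitary_mat r (U1 @\<^sub>c U2)" and V: "unitary_mat p V" and q: "q \<le> r" "q \<le> p"
    and U1: "U1 \<in> carrier_mat r q" and U2: "U2 \<in> carrier_mat r (r - q)"
    and S1: "S1 \<in> carrier_mat q q" and S2: "S2 \<in> carrier_mat (r - q) (p - q)"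
    and B: "B \<in> carrier_mat r m" and X1: "X1 \<in> carrier_mat m q" and X2: "X2 \<in> carrier_mat m (p - q)"
    and X1_eq: "S1 * mat_adjoint X1 = - (mat_adjoint U1 * B)"
  shows "B + M * (V * mat_adjoint (X1 @\<^sub>c X2)) = U2 * (mat_adjoint U2 * B + S2 * mat_adjoint X2)"
proof -
  let ?U = "U1 @\<^sub>c U2" and ?S = "four_block_mat S1 (0\<^sub>m q (p - q)) (0\<^sub>m (r - q) q) S2"
  let ?X = "X1 @\<^sub>c X2"
  have Uc: "?U \<in> carrier_mat r r" and Vc: "V \<in> carrier_mat p p" and VV: "mat_adjoint V * V = 1\<^sub>m p"
    using U V by (auto simp: unitary_mat_def)
  have Sc: "?S \<in> carrier_mat r p"
    using four_block_carrier_mat[OF S1 S2] q by simp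
  have Xc: "?X \<in> carrier_mat m p"
    using carrier_append_cols[OF X1 X2] q by simp
  note U1' = mat_adjoint_carrier[OF U1] and U2' = mat_adjoint_carrier[OF U2]
  note X1' = mat_adjoint_carrier[OF X1] and X2' = mat_adjoint_carrier[OF X2]
  have "M * (V * mat_adjoint ?X) = ?U * ?S * ((mat_adjoint V * V) * mat_adjoint ?X)"
    unfolding M using Vc carrier_matD[OF Uc] carrier_matD[OF Sc] carrier_matD[OF Xc]
    by (simp add: assoc_mult_mat_dim del: index_mat_four_block)
  also have "\<dots> = (U1 * S1 @\<^sub>c U2 * S2) * (mat_adjoint X1 @\<^sub>r mat_adjoint X2)"
    unfolding VV left_mult_one_mat[OF mat_adjoint_carrier[OF Xc]]
    unfolding append_cols_mult_block_diag[OF U1 U2 S1 S2] mat_adjoint_append_cols[OF X1 X2] ..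
  also have "\<dots> = U1 * S1 * mat_adjoint X1 + U2 * S2 * mat_adjoint X2"
    using U1 U2 S1 S2 X1 X2 by (intro append_cols_mult_append_rows) auto
  also have "U1 * S1 * mat_adjoint X1 = U1 * (- (mat_adjoint U1 * B))"
    using assoc_mult_mat[OF U1 S1 X1'] X1_eq by simp
  also have "\<dots> = - (U1 * (mat_adjoint U1 * B))"
    using U1 B by simp
  also have "U2 * S2 * mat_adjoint X2 = U2 * (S2 * mat_adjoint X2)"
    using U2 S2 X2' by (rule assoc_mult_mat)
  finally have 1: "M * (V * mat_adjoint ?X) = - (U1 * (mat_adjoint U1 * B)) + U2 * (S2 * mat_adjoint X2)" .
  have "B = (U1 * mat_adjoint U1 + U2 * mat_adjoint U2) * B"
    using unitary_append_cols(5)[OF U U1 U2] q B by simp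
  also have "\<dots> = U1 * (mat_adjoint U1 * B) + U2 * (mat_adjoint U2 * B)"
    using add_mult_distrib_mat[OF mult_carrier_mat[OF U1 U1'] mult_carrier_mat[OF U2 U2'] B]
      assoc_mult_mat[OF U1 U1' B] assoc_mult_mat[OF U2 U2' B] by simp
  finally have 2: "B = U1 * (mat_adjoint U1 * B) + U2 * (mat_adjoint U2 * B)" .
  have "B + M * (V * mat_adjoint ?X) =
      (U1 * (mat_adjoint U1 * B) + U2 * (mat_adjoint U2 * B)) +
      (- (U1 * (mat_adjoint U1 * B)) + U2 * (S2 * mat_adjoint X2))"
    unfolding 1 by (subst (1) 2) simp
  also have "\<dots> = U2 * (mat_adjoint U2 * B) + U2 * (S2 * mat_adjoint X2)"
    by (rule eq_matI) (use U1 U2 B S2 X2 in simp_all)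
  also have "\<dots> = U2 * (mat_adjoint U2 * B + S2 * mat_adjoint X2)"
    using mult_add_distrib_mat[OF U2 mult_carrier_mat[OF U2' B] mult_carrier_mat[OF S2 X2']] by simp
  finally show ?thesis .
qed

text \<open>The matrix \<open>X = [X1, X2]\<close> has \<open>X\<^sup>* X = diag (X1\<^sup>* X1, I)\<close>, so it fails to be an isometry
  only in its leading block, and \<open>I - U U\<^sup>* = V (I - X\<^sup>* X) V\<^sup>*\<close> inherits only that block.\<close>

lemma coisometry_defect:
  assumes V: "unitary_mat p (V1 @\<^sub>c V2)" and V1: "V1 \<in> carrier_mat p q" and V2: "V2 \<in> carrier_mat p (p - q)"
    and q: "q \<le> p" and X1: "X1 \<in> carrier_mat m q" and X2: "X2 \<in> carrier_mat m (p - q)"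
    and X22: "mat_adjoint X2 * X2 = 1\<^sub>m (p - q)" and X12: "mat_adjoint X1 * X2 = 0\<^sub>m q (p - q)"
    and U: "U = (V1 @\<^sub>c V2) * mat_adjoint (X1 @\<^sub>c X2)"
  shows "1\<^sub>m p - U * mat_adjoint U = V1 * (1\<^sub>m q - mat_adjoint X1 * X1) * mat_adjoint V1"
proof -
  let ?V = "V1 @\<^sub>c V2" and ?X = "X1 @\<^sub>c X2" and ?G = "mat_adjoint X1 * X1"
  have Vc: "?V \<in> carrier_mat p p" and Xc: "?X \<in> carrier_mat m p"
    using carrier_append_cols[OF V1 V2] carrier_append_cols[OF X1 X2] q by simp_all
  have G: "?G \<in> carrier_mat q q"
    using X1 by (auto intro!: mult_carrier_mat)
  note V1' = mat_adjoint_carrier[OF V1] and V2' = mat_adjoint_carrier[OF V2]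
  have "mat_adjoint X2 * X1 = mat_adjoint (mat_adjoint X1 * X2)"
    using X1 X2 by (simp add: mat_adjoint_mult)
  also have "\<dots> = 0\<^sub>m (p - q) q"
    unfolding X12 by (rule eq_matI) auto
  finally have X21: "mat_adjoint X2 * X1 = 0\<^sub>m (p - q) q" .
  have "mat_adjoint ?X * ?X = four_block_mat ?G (0\<^sub>m q (p - q)) (0\<^sub>m (p - q) q) (1\<^sub>m (p - q))"
    unfolding mat_adjoint_append_cols[OF X1 X2]
    using append_rows_mult_append_cols[OF mat_adjoint_carrier[OF X1] mat_adjoint_carrier[OF X2] X1 X2]
    by (simp add: X12 X21 X22)
  then have VXX: "?V * (mat_adjoint ?X * ?X) = V1 * ?G @\<^sub>c V2"
    using append_cols_mult_block_diag[OF V1 V2 G one_carrier_mat] V2 by simp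
  have "U * mat_adjoint U = ?V * (mat_adjoint ?X * ?X) * mat_adjoint ?V"
    unfolding U using carrier_matD[OF Vc] carrier_matD[OF Xc] by (simp add: mat_adjoint_mult assoc_mult_mat_dim)
  also have "\<dots> = V1 * ?G * mat_adjoint V1 + V2 * mat_adjoint V2"
    unfolding VXX mat_adjoint_append_cols[OF V1 V2]
    using V1 V2 G by (intro append_cols_mult_append_rows) auto
  finally have UU: "U * mat_adjoint U = V1 * ?G * mat_adjoint V1 + V2 * mat_adjoint V2" .
  have "1\<^sub>m p - U * mat_adjoint U =
      (V1 * mat_adjoint V1 + V2 * mat_adjoint V2) - (V1 * ?G * mat_adjoint V1 + V2 * mat_adjoint V2)"
    using unitary_append_cols(5)[OF V V1 V2] q UU by simp
  also have "\<dots> = V1 * mat_adjoint V1 - V1 * ?G * mat_adjoint V1"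
    by (rule eq_matI) (use V1 V2 in simp_all)
  also have "\<dots> = V1 * (1\<^sub>m q - ?G) * mat_adjoint V1"
    using minus_mult_distrib_mat[OF V1 mult_carrier_mat[OF V1 G] V1']
      mult_minus_distrib_mat[OF V1 one_carrier_mat G] V1 by simp
  finally show ?thesis .
qed

text \<open>The least-squares factor is \<open>X\<^sup>* = - L B\<close> with \<open>L = W U\<^sup>*\<close> and \<open>W\<close> an inverse of \<open>S\<close>. If \<open>B B\<^sup>*\<close>
  were equal to \<open>Y\<close>, then \<open>X\<^sup>* X = L Y L\<^sup>* = I\<close>; the defect therefore measures \<open>Y - B B\<^sup>*\<close> alone.\<close>

lemma least_squares_gram_defect:
  fixes Y Z :: "complex mat"
  assumes S: "S \<in> carrier_mat q q" and W: "W \<in> carrier_mat q q" and WS: "W * S = 1\<^sub>m q"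
    and U: "U \<in> carrier_mat r q" and B: "B \<in> carrier_mat r m" and Y: "Y \<in> carrier_mat r r"
    and SY: "mat_adjoint U * Y * U = S * mat_adjoint S"
    and X: "mat_adjoint X = - (W * mat_adjoint U * B)"
  shows "1\<^sub>m q - mat_adjoint X * X =
    (W * mat_adjoint U) * (Y - B * mat_adjoint B) * mat_adjoint (W * mat_adjoint U)"
proof -
  let ?L = "W * mat_adjoint U"
  have L: "?L \<in> carrier_mat q r"
    using W U by auto
  note L' = mat_adjoint_carrier[OF L]
  have BB: "B * mat_adjoint B \<in> carrier_mat r r"
    using B by (auto intro!: mult_carrier_mat)
  have "X = mat_adjoint (- (?L * B))"
    using X by (metis mat_adjoint_mat_adjoint)
  then have "mat_adjoint X * X = - (?L * B) * - mat_adjoint (?L * B)"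
    unfolding X by (simp only: mat_adjoint_uminus)
  also have "\<dots> = (?L * B) * mat_adjoint (?L * B)"
    by (rule eq_matI) auto
  also have "\<dots> = ?L * (B * mat_adjoint B) * mat_adjoint ?L"
    using carrier_matD[OF L] carrier_matD[OF B]
    by (simp add: mat_adjoint_mult[of "?L" B] assoc_mult_mat_dim del: index_mult_mat(1))
  finally have XX: "mat_adjoint X * X = ?L * (B * mat_adjoint B) * mat_adjoint ?L" .
  have "1\<^sub>m q = (W * S) * mat_adjoint (W * S)"
    unfolding WS by (rule eq_matI) (auto simp: scalar_prod_def)
  also have "\<dots> = W * (S * mat_adjoint S) * mat_adjoint W"
    using W S by (simp add: mat_adjoint_mult assoc_mult_mat_dim)
  also have "\<dots> = ?L * Y * mat_adjoint ?L"
    unfolding SY[symmetric] using W U Y by (simp add: mat_adjoint_mult assoc_mult_mat_dim)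
  finally have 1: "1\<^sub>m q = ?L * Y * mat_adjoint ?L" .
  show ?thesis
    unfolding XX 1
    using minus_mult_distrib_mat[OF mult_carrier_mat[OF L Y] mult_carrier_mat[OF L BB] L']
      mult_minus_distrib_mat[OF L Y BB] by simp
qed

section \<open>The residual and the unitarity defect\<close>

theorem theorem4p3:
  fixes K m p k j1 j2 r q :: nat
    and A B C D P Q :: "complex mat"
    and A11 A12 A21 A22 B1 B2 C1 C2 \<Sigma>1 \<Sigma>2 :: "complex mat"
    and UC SC VC UC1 UC2 SC1 SC2 VB VB1 VB2 U :: "complex mat"
    and \<sigma> s :: "nat \<Rightarrow> real"
    and \<epsilon> \<gamma> QE QU Q1 Q2 :: real
  assumes A: "A \<in> carrier_mat K K" and B: "B \<in> carrier_mat K m"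
    and C: "C \<in> carrier_mat p K" and D: "D \<in> carrier_mat p m"
    and p_le_m: "p \<le> m"
    and stable: "stable_mat A"
    and hankel: "hankel_singular_values A B C \<sigma>"
    and k: "k + 1 \<le> K" and eps: "0 \<le> \<epsilon>"
    and j1: "j1 \<le> k + 1" and j2: "k + 1 \<le> j2"
    and cluster: "{j \<in> {1..K}. \<bar>\<sigma> j - \<sigma> (k + 1)\<bar> \<le> \<epsilon>} = {j1..j2}"
    and r: "r = j2 - j1 + 1"
    (* balanced form *)
    and Sigma1: "\<Sigma>1 = real_diag (map \<sigma> ([1..<j1] @ [j2 + 1..<K + 1]))"
    and Sigma2: "\<Sigma>2 = real_diag (map \<sigma> [j1..<j2 + 1])"
    and P: "P = four_block_mat \<Sigma>1 (0\<^sub>m (K - r) r) (0\<^sub>m r (K - r)) \<Sigma>2" and Q: "Q = P"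
    and gram_P: "controllability_gramian A B P"
    and gram_Q: "observability_gramian A C Q"
    (* conformal partition *)
    and A_blocks: "A11 \<in> carrier_mat (K - r) (K - r)" "A12 \<in> carrier_mat (K - r) r"
      "A21 \<in> carrier_mat r (K - r)" "A22 \<in> carrier_mat r r"
      "A = four_block_mat A11 A12 A21 A22"
    and B_blocks: "B1 \<in> carrier_mat (K - r) m" "B2 \<in> carrier_mat r m" "B = B1 @\<^sub>r B2"
    and C_blocks: "C1 \<in> carrier_mat p (K - r)" "C2 \<in> carrier_mat p r" "C = C1 @\<^sub>c C2"
    (* construction of U *)
    and gamma: "0 \<le> \<gamma>"
    and svd: "is_svd (mat_adjoint C2) UC SC VC"
    and q: "1 \<le> q" "q \<le> min r p"
    and UC_blocks: "UC1 \<in> carrier_mat r q" "UC2 \<in> carrier_mat r (r - q)" "UC = UC1 @\<^sub>c UC2"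
    and SC_blocks: "SC1 \<in> carrier_mat q q" "SC2 \<in> carrier_mat (r - q) (p - q)"
      "SC = four_block_mat SC1 (0\<^sub>m q (p - q)) (0\<^sub>m (r - q) q) SC2"
    and SC1_inv: "invertible_mat SC1"
    and q_thresh: "spectral_norm SC2 \<le> \<gamma>"
    and q_least: "\<And>q'. 1 \<le> q' \<Longrightarrow> q' < q \<Longrightarrow> \<not> spectral_norm (trailing_block q' SC) \<le> \<gamma>"
    and VB1: "VB1 \<in> carrier_mat m q"
      "mat_adjoint VB1 = - (the (mat_inverse SC1) * mat_adjoint UC1 * B2)"
    and VB2: "VB2 \<in> carrier_mat m (p - q)"
      "mat_adjoint VB2 * VB2 = 1\<^sub>m (p - q)" "mat_adjoint VB1 * VB2 = 0\<^sub>m q (p - q)"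
    and VB: "VB = VB1 @\<^sub>c VB2"
    and U: "U = VC * mat_adjoint VB"
    (* quantities in the bounds *)
    and s: "singular_values C2 s" "p = q \<Longrightarrow> s (p + 1) = 0"
    and QE: "QE = spectral_norm (B2 + mat_adjoint C2 * U)"
    and QU: "QU = spectral_norm (1\<^sub>m p - U * mat_adjoint U)"
    and Q1: "Q1 = \<gamma> + sqrt (\<gamma>\<^sup>2 + 4 * \<epsilon> * spectral_norm A22)"
    and Q2: "Q2 = 4 * sqrt 2 * \<epsilon> * frobenius_norm A22 /
               ((s q - s (q + 1)) - 4 * \<epsilon> * frobenius_norm A22) * spectral_norm B2"
  shows "((s q - s (q + 1)) - 4 * \<epsilon> * frobenius_norm A22 > 0 \<longrightarrow> QE \<le> Q1 + Q2) \<and>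
         (q = r \<longrightarrow> QE \<le> 0 + 0) \<and>
         (hermitian_mat A22 \<longrightarrow> QE \<le> Q1 + 0) \<and>
         QU \<le> 4 * (s q) powi (-2) * \<epsilon> * spectral_norm A22 \<and>
         (hermitian_mat A22 \<longrightarrow> QU = 0)"
proof -
  let ?N = "spectral_norm A22"
  have "{j1..j2} \<subseteq> {1..K}"
    using cluster by blast
  then have j: "1 \<le> j1" "j1 \<le> j2" "j2 \<le> K"
    using j1 j2 by auto
  have r_le: "r \<le> K"
    using r j by simp
  have q': "q \<le> r" "q \<le> p"
    using q by simp_all

  \<comment> \<open>Index shift: the cluster \<open>\<sigma> j1, \<dots>, \<sigma> j2\<close> is the diagonal of \<open>\<Sigma>2\<close>, which is indexed from \<open>0\<close>.\<close>
  define f where "f i = \<sigma> (j1 + i)" for i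
  define c where "c = \<sigma> (k + 1)"
  have f: "\<bar>f i - c\<bar> \<le> \<epsilon>" if "i < r" for i
  proof -
    have "j1 + i \<in> {j1..j2}"
      using that r j by simp
    then show ?thesis
      unfolding cluster[symmetric] f_def c_def by simp
  qed
  have S2_diag: "\<Sigma>2 = mat_diag r (\<lambda>i. complex_of_real (f i))"
    unfolding Sigma2 real_diag_def f_def using r j
    by (intro eq_matI) (auto simp: mat_diag_def simp del: upt_Suc)
  have S1c: "\<Sigma>1 \<in> carrier_mat (K - r) (K - r)"
    unfolding Sigma1 real_diag_def using r j by (intro carrier_matI) (auto simp: mat_diag_def simp del: upt_Suc)
  have S2c: "\<Sigma>2 \<in> carrier_mat r r"
    by (simp add: S2_diag)

  define X where "X = B2 * mat_adjoint B2"
  define Y where "Y = mat_adjoint C2 * C2"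
  have Xc: "X \<in> carrier_mat r r" and Yc: "Y \<in> carrier_mat r r"
    unfolding X_def Y_def
    using mult_carrier_mat[OF B_blocks(2) mat_adjoint_carrier[OF B_blocks(2)]]
      mult_carrier_mat[OF mat_adjoint_carrier[OF C_blocks(2)] C_blocks(2)] by simp_all
  have ctrl: "A22 * \<Sigma>2 + \<Sigma>2 * mat_adjoint A22 + X = 0\<^sub>m r r"
    unfolding X_def
  proof (rule lyapunov_trailing_block[OF A_blocks(1-4) B_blocks(1,2) S1c S2c])
    show "four_block_mat A11 A12 A21 A22 * four_block_mat \<Sigma>1 (0\<^sub>m (K - r) r) (0\<^sub>m r (K - r)) \<Sigma>2 +
        four_block_mat \<Sigma>1 (0\<^sub>m (K - r) r) (0\<^sub>m r (K - r)) \<Sigma>2 * mat_adjoint (four_block_mat A11 A12 A21 A22) +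
        (B1 @\<^sub>r B2) * mat_adjoint (B1 @\<^sub>r B2) = 0\<^sub>m (K - r + r) (K - r + r)"
      using gram_P A r_le unfolding controllability_gramian_def P A_blocks(5) B_blocks(3)
      by (metis carrier_matD(1) le_add_diff_inverse2)
  qed
  \<comment> \<open>The observability equation is the controllability equation of the adjoint system.\<close>
  have obs: "mat_adjoint A22 * \<Sigma>2 + \<Sigma>2 * A22 + Y = 0\<^sub>m r r"
  proof -
    note adj = mat_adjoint_carrier[OF A_blocks(1)] mat_adjoint_carrier[OF A_blocks(3)]
      mat_adjoint_carrier[OF A_blocks(2)] mat_adjoint_carrier[OF A_blocks(4)]
    have "mat_adjoint A22 * \<Sigma>2 + \<Sigma>2 * mat_adjoint (mat_adjoint A22) +
        mat_adjoint C2 * mat_adjoint (mat_adjoint C2) = 0\<^sub>m r r"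
    proof (rule lyapunov_trailing_block[OF adj mat_adjoint_carrier[OF C_blocks(1)]
          mat_adjoint_carrier[OF C_blocks(2)] S1c S2c])
      have "mat_adjoint A * P + P * A + mat_adjoint C * C = 0\<^sub>m K K"
        using gram_Q A unfolding observability_gramian_def Q by auto
      then show "four_block_mat (mat_adjoint A11) (mat_adjoint A21) (mat_adjoint A12) (mat_adjoint A22) *
            four_block_mat \<Sigma>1 (0\<^sub>m (K - r) r) (0\<^sub>m r (K - r)) \<Sigma>2 +
          four_block_mat \<Sigma>1 (0\<^sub>m (K - r) r) (0\<^sub>m r (K - r)) \<Sigma>2 *
            mat_adjoint (four_block_mat (mat_adjoint A11) (mat_adjoint A21) (mat_adjoint A12) (mat_adjoint A22)) +
          (mat_adjoint C1 @\<^sub>r mat_adjoint C2) * mat_adjoint (mat_adjoint C1 @\<^sub>r mat_adjoint C2) =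
          0\<^sub>m (K - r + r) (K - r + r)"
        unfolding mat_adjoint_four_block_mat[OF A_blocks(1-4), symmetric]
          mat_adjoint_append_cols[OF C_blocks(1,2), symmetric] A_blocks(5)[symmetric]
          C_blocks(3)[symmetric] P[symmetric] mat_adjoint_mat_adjoint
        using r_le by simp
    qed
    then show ?thesis
      by (simp add: Y_def)
  qed

  have "spectral_norm (X - Y) \<le> 4 * \<epsilon> * ?N"
    using A_blocks(4) Xc Yc ctrl[unfolded S2_diag] obs[unfolded S2_diag] f eps by (rule gramian_gap_norm)
  moreover have "Y - X = - (X - Y)"
    by (rule eq_matI) (use Xc Yc in auto)
  ultimately have gap: "spectral_norm (X - Y) \<le> 4 * \<epsilon> * ?N" "spectral_norm (Y - X) \<le> 4 * \<epsilon> * ?N"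
    by (simp_all add: spectral_norm_uminus)
  have herm: "Y - X = 0\<^sub>m r r" if "hermitian_mat A22"
  proof -
    have "X - Y = 0\<^sub>m r r"
      using A_blocks(4) Xc Yc ctrl[unfolded S2_diag] obs[unfolded S2_diag] that by (rule gramian_gap_hermitian)
    then show ?thesis
      using \<open>Y - X = - (X - Y)\<close> by simp auto
  qed

  have unitary: "unitary_mat r UC" "unitary_mat p VC" and C2_svd: "mat_adjoint C2 = UC * SC * mat_adjoint VC"
    using svd C_blocks(2) by (simp_all add: is_svd_def)
  note UC = unitary(1)[unfolded UC_blocks(3)]
  note C2_svd' = C2_svd[unfolded UC_blocks(3) SC_blocks(3)]
  note grams = svd_compressed_grams[OF C2_svd' UC unitary(2) q' UC_blocks(1,2) SC_blocks(1,2),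
      unfolded mat_adjoint_mat_adjoint, folded Y_def]
  note UC_iso = unitary_append_cols[OF UC UC_blocks(1,2) le_add_diff_inverse[OF q'(1), symmetric]]

  define W where "W = the (mat_inverse SC1)"
  \<comment> \<open>The diagonal of \<open>SC1\<close> is indexed from \<open>0\<close>, the singular values \<open>s\<close> from \<open>1\<close>.\<close>
  have SC1_diag: "SC1 = mat_diag q (\<lambda>i. complex_of_real (s (Suc i)))"
  proof (rule eq_matI)
    fix a b assume "a < dim_row (mat_diag q (\<lambda>i. complex_of_real (s (Suc i))))"
      "b < dim_col (mat_diag q (\<lambda>i. complex_of_real (s (Suc i))))"
    then have ab: "a < q" "b < q"
      by (simp_all add: mat_diag_def)
    have "SC1 $$ (a, b) = SC $$ (a, b)"
      using ab SC_blocks by simp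
    also have "\<dots> = (if a = b then complex_of_real (s (Suc a)) else 0)"
    proof (cases "a = b")
      case True
      then show ?thesis
        using svd_singular_values[OF C_blocks(2) s(1) svd, of a] ab q by simp
    next
      case False
      then show ?thesis
        using svd ab q' C_blocks(2) by (auto simp: is_svd_def)
    qed
    finally show "SC1 $$ (a, b) = mat_diag q (\<lambda>i. complex_of_real (s (Suc i))) $$ (a, b)"
      using ab by (auto simp: mat_diag_def)
  qed (use SC_blocks in \<open>auto simp: mat_diag_def\<close>)
  have W_diag: "W = mat_diag q (\<lambda>i. complex_of_real (inverse (s (Suc i))))"
    and s_nz: "\<And>i. i < q \<Longrightarrow> s (Suc i) \<noteq> 0"
    using invertible_mat_diag_inverse[of q "\<lambda>i. s (Suc i)"] SC1_inv unfolding W_def SC1_diag by blast+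
  have Wc: "W \<in> carrier_mat q q"
    by (simp add: W_diag)
  have WS: "W * SC1 = 1\<^sub>m q" and SW: "SC1 * W = 1\<^sub>m q"
    unfolding W_diag SC1_diag mat_diag_diag using s_nz
    by (auto intro!: eq_matI simp: mat_diag_def simp flip: of_real_mult)
  have s_mono: "0 < s q" "s q \<le> s (Suc i)" if "i < q" for i
  proof -
    have "0 \<le> s q" and "s q \<le> s (Suc i)"
      using s(1) C_blocks(2) q that by (auto simp: singular_values_def sqrt_eigenvalues_def)
    then show "0 < s q" "s q \<le> s (Suc i)"
      using s_nz[of "q - 1"] q by auto
  qed
  have sq: "0 < s q"
    using s_mono(1)[of 0] q by simp
  have W_norm: "spectral_norm W \<le> inverse (s q)"
    unfolding W_diag
  proof (rule spectral_norm_mat_diag)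
    fix i assume "i < q"
    then have "0 < s q" "s q \<le> s (Suc i)"
      by (rule s_mono)+
    then show "cmod (complex_of_real (inverse (s (Suc i)))) \<le> inverse (s q)"
      by (simp add: norm_inverse le_imp_inverse_le)
  qed (use sq in simp)

  have VB1': "mat_adjoint VB1 = - (W * mat_adjoint UC1 * B2)"
    using VB1(2) by (simp add: W_def)

  \<comment> \<open>Statement (b): \<open>I - U U\<^sup>*\<close> is the gap \<open>Y - X\<close> compressed twice, once with the factor
    \<open>L = W UC1\<^sup>*\<close> of norm at most \<open>1 / s q\<close> and once with an isometry.\<close>
  let ?L = "W * mat_adjoint UC1"
  have Lc: "?L \<in> carrier_mat q r"
    using Wc UC_blocks(1) by auto
  have UC1_norm: "spectral_norm (mat_adjoint UC1) \<le> 1"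
    using spectral_norm_isometry[OF UC_iso(1)] by (simp add: spectral_norm_mat_adjoint)
  have L_norm: "spectral_norm ?L \<le> inverse (s q)"
  proof -
    have "spectral_norm ?L \<le> spectral_norm W * 1"
      using Wc UC_blocks(1) UC1_norm by (intro spectral_norm_mult_right_le[of _ q q _ r]) auto
    then show ?thesis
      using W_norm by simp
  qed
  have VB1_defect: "1\<^sub>m q - mat_adjoint VB1 * VB1 = ?L * (Y - X) * mat_adjoint ?L"
    unfolding X_def
    by (rule least_squares_gram_defect[OF SC_blocks(1) Wc WS UC_blocks(1) B_blocks(2) Yc grams(1) VB1'])
  obtain VC1 VC2 where VC: "VC1 \<in> carrier_mat p q" "VC2 \<in> carrier_mat p (p - q)" "VC = VC1 @\<^sub>c VC2"
    using append_cols_split[of VC p q "p - q"] unitary(2) q' by (auto simp: unitary_mat_def)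
  have VC1_norm: "spectral_norm VC1 \<le> 1"
    using unitary_append_cols(1)[OF unitary(2)[unfolded VC(3)] VC(1,2)] q' by (intro spectral_norm_isometry) simp
  have defect: "1\<^sub>m p - U * mat_adjoint U = VC1 * (?L * (Y - X) * mat_adjoint ?L) * mat_adjoint VC1"
    unfolding VB1_defect[symmetric]
    using unitary(2)[unfolded VC(3)] VC(1,2) q'(2) VB1(1) VB2 U[unfolded VB VC(3)] by (rule coisometry_defect)
  have YX: "Y - X \<in> carrier_mat r r"
    using Xc by (rule minus_carrier_mat)
  have LYXL: "?L * (Y - X) * mat_adjoint ?L \<in> carrier_mat q q"
    using mult_carrier_mat[OF mult_carrier_mat[OF Lc YX] mat_adjoint_carrier[OF Lc]] .
  have QU_le: "QU \<le> (inverse (s q))\<^sup>2 * spectral_norm (Y - X)"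
  proof -
    have "QU \<le> 1\<^sup>2 * spectral_norm (?L * (Y - X) * mat_adjoint ?L)"
      unfolding QU defect using VC(1) VC1_norm LYXL by (rule spectral_norm_congruence_le)
    also have "\<dots> \<le> (inverse (s q))\<^sup>2 * spectral_norm (Y - X)"
      using spectral_norm_congruence_le[OF Lc L_norm YX] by simp
    finally show ?thesis .
  qed
  have b1: "QU \<le> 4 * (s q) powi (-2) * \<epsilon> * ?N"
  proof -
    have "QU \<le> (inverse (s q))\<^sup>2 * (4 * \<epsilon> * ?N)"
      using QU_le mult_left_mono[OF gap(2), of "(inverse (s q))\<^sup>2"] by simp
    also have "(inverse (s q))\<^sup>2 = (s q) powi (-2)"
      by (simp add: power_int_def)
    finally show ?thesis
      by (simp add: mult_ac)
  qed
  have b2: "hermitian_mat A22 \<longrightarrow> QU = 0"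
    using QU_le herm spectral_norm_nonneg[of "1\<^sub>m p - U * mat_adjoint U"] by (auto simp: QU)

  \<comment> \<open>Statement (a): only the components along \<open>UC2\<close> survive in the residual. They are
    \<open>R = UC2\<^sup>* B2\<close>, controlled by \<open>R R\<^sup>* = UC2\<^sup>* X UC2\<close>, and \<open>SC2 VB2\<^sup>*\<close>, controlled by \<open>\<gamma>\<close>.\<close>
  let ?R = "mat_adjoint UC2 * B2"
  note UC2' = mat_adjoint_carrier[OF UC_blocks(2)] and VB2' = mat_adjoint_carrier[OF VB2(1)]
  have Rc: "?R \<in> carrier_mat (r - q) m" and TVc: "SC2 * mat_adjoint VB2 \<in> carrier_mat (r - q) m"
    using mult_carrier_mat[OF UC2' B_blocks(2)] mult_carrier_mat[OF SC_blocks(2) VB2'] by simp_all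
  have "SC1 * mat_adjoint VB1 = SC1 * (- (W * (mat_adjoint UC1 * B2)))"
    unfolding VB1' using assoc_mult_mat[OF Wc mat_adjoint_carrier[OF UC_blocks(1)] B_blocks(2)] by simp
  also have "\<dots> = - (SC1 * (W * (mat_adjoint UC1 * B2)))"
    using SC_blocks(1) Wc UC_blocks(1) by simp
  also have "\<dots> = - ((SC1 * W) * (mat_adjoint UC1 * B2))"
    using assoc_mult_mat[OF SC_blocks(1) Wc mult_carrier_mat[OF mat_adjoint_carrier[OF UC_blocks(1)] B_blocks(2)]] by simp
  also have "\<dots> = - (mat_adjoint UC1 * B2)"
    unfolding SW left_mult_one_mat[OF mult_carrier_mat[OF mat_adjoint_carrier[OF UC_blocks(1)] B_blocks(2)]] ..
  finally have SVB1: "SC1 * mat_adjoint VB1 = - (mat_adjoint UC1 * B2)" .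
  have residual: "B2 + mat_adjoint C2 * U = UC2 * (?R + SC2 * mat_adjoint VB2)"
    unfolding U VB
    by (rule truncated_svd_residual[OF C2_svd' UC unitary(2) q' UC_blocks(1,2) SC_blocks(1,2)
          B_blocks(2) VB1(1) VB2(1) SVB1])

  have R_norm: "spectral_norm ?R \<le> sqrt (\<gamma>\<^sup>2 + 4 * \<epsilon> * ?N)"
  proof -
    have UC2_norm: "spectral_norm (mat_adjoint UC2) \<le> 1"
      using spectral_norm_isometry[OF UC_iso(4)] by (simp add: spectral_norm_mat_adjoint)
    have XY: "X - Y \<in> carrier_mat r r"
      using Yc by (rule minus_carrier_mat)
    have "?R * mat_adjoint ?R = mat_adjoint UC2 * X * UC2"
      unfolding X_def using UC_blocks(2) B_blocks(2) by (simp add: mat_adjoint_mult assoc_mult_mat_dim)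
    \<comment> \<open>Trade \<open>B2 B2\<^sup>*\<close> for \<open>C2\<^sup>* C2\<close>, whose compression to \<open>UC2\<close> is \<open>SC2 SC2\<^sup>*\<close>.\<close>
    also have "X = Y + (X - Y)"
      by (rule eq_matI) (use Xc Yc in auto)
    also have "mat_adjoint UC2 * (Y + (X - Y)) * UC2 =
        mat_adjoint UC2 * Y * UC2 + mat_adjoint UC2 * (X - Y) * UC2"
      using mult_add_distrib_mat[OF UC2' Yc XY]
        add_mult_distrib_mat[OF mult_carrier_mat[OF UC2' Yc] mult_carrier_mat[OF UC2' XY] UC_blocks(2)] by simp
    finally have RR: "?R * mat_adjoint ?R = SC2 * mat_adjoint SC2 + mat_adjoint UC2 * (X - Y) * UC2"
      by (simp only: grams(2))
    have g2: "spectral_norm (SC2 * mat_adjoint SC2) \<le> \<gamma>\<^sup>2"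
      using spectral_norm_mult[OF SC_blocks(2) mat_adjoint_carrier[OF SC_blocks(2)]]
        mult_mono[OF q_thresh q_thresh gamma spectral_norm_nonneg]
      by (simp add: spectral_norm_mat_adjoint power2_eq_square)
    have "spectral_norm (mat_adjoint UC2 * (X - Y) * UC2) \<le> 1\<^sup>2 * spectral_norm (X - Y)"
      using spectral_norm_congruence_le[OF UC2' UC2_norm XY] by simp
    then have d2: "spectral_norm (mat_adjoint UC2 * (X - Y) * UC2) \<le> 4 * \<epsilon> * ?N"
      using gap(1) by simp
    have "(spectral_norm ?R)\<^sup>2 \<le> spectral_norm (?R * mat_adjoint ?R)"
      using spectral_norm_power2_le[of "mat_adjoint ?R"] by (simp add: spectral_norm_mat_adjoint)
    also have "\<dots> \<le> spectral_norm (SC2 * mat_adjoint SC2) + spectral_norm (mat_adjoint UC2 * (X - Y) * UC2)"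
      unfolding RR
      by (rule spectral_norm_triangle[OF mult_carrier_mat[OF SC_blocks(2) mat_adjoint_carrier[OF SC_blocks(2)]]
            mult_carrier_mat[OF mult_carrier_mat[OF UC2' XY] UC_blocks(2)]])
    also have "\<dots> \<le> \<gamma>\<^sup>2 + 4 * \<epsilon> * ?N"
      by (rule add_mono[OF g2 d2])
    finally show ?thesis
      by (rule real_le_rsqrt)
  qed
  have TV_norm: "spectral_norm (SC2 * mat_adjoint VB2) \<le> \<gamma>"
  proof -
    have "spectral_norm (mat_adjoint VB2) \<le> 1"
      using spectral_norm_isometry[OF VB2(2)] by (simp add: spectral_norm_mat_adjoint)
    then show ?thesis
      using spectral_norm_mult_right_le[OF SC_blocks(2) VB2'] q_thresh by fastforce
  qed
  have a1: "QE \<le> Q1"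
  proof -
    have "QE \<le> 1 * spectral_norm (?R + SC2 * mat_adjoint VB2)"
      unfolding QE residual
      by (rule spectral_norm_mult_left_le[OF UC_blocks(2) add_carrier_mat[OF TVc] spectral_norm_isometry[OF UC_iso(4)]])
    also have "\<dots> \<le> spectral_norm ?R + spectral_norm (SC2 * mat_adjoint VB2)"
      using spectral_norm_triangle[OF Rc TVc] by simp
    finally show ?thesis
      unfolding Q1 using R_norm TV_norm by simp
  qed
  have a2: "QE \<le> 0" if "q = r"
  proof -
    define Z where "Z = ?R + SC2 * mat_adjoint VB2"
    have "UC2 \<in> carrier_mat r 0" "Z \<in> carrier_mat 0 m"
      using UC_blocks(2) add_carrier_mat[OF TVc] that by (simp_all add: Z_def)
    \<comment> \<open>Every entry is an empty sum.\<close>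
    then have "UC2 * Z = 0\<^sub>m r m"
      by (intro eq_matI) (simp_all add: scalar_prod_def)
    then show ?thesis
      by (simp add: QE residual Z_def)
  qed
  have "0 \<le> Q2" if "(s q - s (q + 1)) - 4 * \<epsilon> * frobenius_norm A22 > 0"
    unfolding Q2 using that eps
    by (intro mult_nonneg_nonneg divide_nonneg_pos spectral_norm_nonneg) (auto simp: frobenius_norm_def L2_set_nonneg)
  then show ?thesis
    using a1 a2 b1 b2 by auto
qed

end
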